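(* Assume that for every $u\in\mathrm{UC}_\kappa$ the map $[0,\infty)\to\mathrm{UC}_\kappa$, $h\mapsto\mathcal{E}_hu$, is continuous (w.r.t. $\|\cdot\|_\kappa$). Let $t\ge0$ and let $(\pi_n)_{n\in\mathbb{N}}\subset P_t$ with $\pi_n\subset\pi_{n+1}$ for all $n\in\mathbb{N}$ and $|\pi_n|_\infty\searrow0$ as $n\to\infty$. Then, for all $u\in\mathrm{UC}_\kappa$, $$\mathcal{E}_{\pi_n}u\nearrow\mathscr{S}(t)u\quad\text{as }n\to\infty.$$ In particular, $$\mathscr{S}(t)u=\sup_{n\in\mathbb{N}}\mathcal{E}_{\frac tn}^{\,n}u=\lim_{n\to\infty}\mathcal{E}_{2^{-n}t}^{\,2^n}u\quad\text{for all }u\in\mathrm{UC}_\kappa,$$ where the supremum and the limit are understood pointwise and the exponents denote iterated composition.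
   Context: Setting: $\Lambda$ is a nonempty set, $(M,d)$ is a separable metric space, and $\kappa\colon M\to(0,\infty)$ is continuous and bounded. $\|u\|_\infty=\sup_{x\in M}|u(x)|$; $\|u\|_\kappa=\|\kappa u\|_\infty$; $\|u\|_{\mathrm{Lip}}=\inf\{L\ge 0: |u(x)-u(y)|\le L d(x,y)\ \forall x,y\in M\}$. $\mathrm{C}_\kappa$ is the space of continuous $u\colon M\to\mathbb{R}$ with $\|u\|_\kappa<\infty$; $\mathrm{Lip}_{\rm b}$ is the space of bounded Lipschitz functions $M\to\mathbb{R}$; $\mathrm{UC}_\kappa$ is the closure of $\mathrm{Lip}_{\rm b}$ in $(\mathrm{C}_\kappa,\|\cdot\|_\kappa)$. For $u_n,u\in\mathrm{UC}_\kappa$, $u_n\nearrow u$ means $u_n\le u_{n+1}$ for all $n$ and $u_n(x)\to u(x)$ for all $x\in M$. A Feller semigroup is a family $T=(T(t))_{t\ge0}$ of possibly nonlinear operators such that (i) $T(t)\colon\mathrm{UC}_\kappa\to\mathrm{UC}_\kappa$ is continuous for all $t\ge 0$; (ii) $T(0)u=u$ and $T(s+t)u=T(s)T(t)u$ for all $s,t\ge0$, $u\in\mathrm{UC}_\kappa$; (iii) each $T(t)$ is monotone and continuous from below, i.e. $u_n\nearrow u$ in $\mathrm{UC}_\kappa$ implies $T(t)u_n\nearrow T(t)u$. Standing assumptions: (A1) for every $\lambda\in\Lambda$, $S_\lambda=(S_\lambda(t))_{t\ge0}$ is a Feller semigroup of linear operators with $S_\lambda(t)1=1$ for all $t\geq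 0$; (A2) there are $\alpha,\beta\in\mathbb{R}$ with $\|S_\lambda(t)u\|_\kappa\le e^{\alpha t}\|u\|_\kappa$ and $\|S_\lambda(t)u\|_{\mathrm{Lip}}\le e^{\beta t}\|u\|_{\mathrm{Lip}}$ for all $u\in\mathrm{Lip}_{\rm b}$, $\lambda\in\Lambda$, $t\ge0$. For $h\ge0$, $u\in\mathrm{UC}_\kappa$: $(\mathcal{E}_hu)(x)=\sup_{\lambda\in\Lambda}(S_\lambda(h)u)(x)$; $\mathcal{E}_h$ maps $\mathrm{UC}_\kappa$ to itself. $P$ is the set of finite subsets $\pi\subset[0,\infty)$ with $0\in\pi$, and $P_t=\{\pi\in P:\max\pi=t\}$. For $\pi=\{t_0,\dots,t_m\}$ with $0=t_0<t_1<\dots<t_m$, $m\ge 1$, $\mathcal{E}_\pi u=\mathcal{E}_{t_1-t_0}\cdots\mathcal{E}_{t_m-t_{m-1}}u$ (composition) and the mesh size is $|\pi|_\infty=\max_{j=1,\dots,m}(t_j-t_{j-1})$; $\mathcal{E}_{\{0\}}u=u$ and $|\{0\}|_\infty=0$. The semigroup envelope is $(\mathscr{S}(t)u)(x)=\sup_{\pi\in P_t}(\mathcal{E}_\pi u)(x)$ for $t\ge0$, $u\in\mathrm{UC}_\kappa$, $x\in M$. *)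

theory Defs
  imports "HOL-Analysis.Analysis"
begin

section \<open>Weighted function spaces\<close>

text \<open>The norms take values in \<open>[0, \<infinity>]\<close>; they are \<open>\<infinity>\<close> on functions that are unbounded
  or not Lipschitz, respectively.\<close>

definition sup_norm :: "('a \<Rightarrow> real) \<Rightarrow> ennreal" where
  "sup_norm u = (SUP x. ennreal \<bar>u x\<bar>)"

definition kappa_norm :: "('a \<Rightarrow> real) \<Rightarrow> ('a \<Rightarrow> real) \<Rightarrow> ennreal" where
  "kappa_norm \<kappa> u = sup_norm (\<lambda>x. \<kappa> x * u x)"

definition Lip_norm :: "('a::metric_space \<Rightarrow> real) \<Rightarrow> ennreal" where
  "Lip_norm u = (INF L\<in>{L. L-lipschitz_on UNIV u}. ennreal L)"

definition C_kappa :: "('a::metric_space \<Rightarrow> real) \<Rightarrow> ('a \<Rightarrow> real) set" where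
  "C_kappa \<kappa> = {u. continuous_on UNIV u \<and> kappa_norm \<kappa> u < \<infinity>}"

definition Lip_b :: "('a::metric_space \<Rightarrow> real) set" where
  "Lip_b = {u. bounded (range u) \<and> (\<exists>L. L-lipschitz_on UNIV u)}"

definition kappa_dist :: "('a \<Rightarrow> real) \<Rightarrow> ('a \<Rightarrow> real) \<Rightarrow> ('a \<Rightarrow> real) \<Rightarrow> real" where
  "kappa_dist \<kappa> u v = enn2real (kappa_norm \<kappa> (\<lambda>x. u x - v x))"

definition C_kappa_top :: "('a::metric_space \<Rightarrow> real) \<Rightarrow> ('a \<Rightarrow> real) topology" where
  "C_kappa_top \<kappa> = Metric_space.mtopology (C_kappa \<kappa>) (kappa_dist \<kappa>)"

definition UC_kappa :: "('a::metric_space \<Rightarrow> real) \<Rightarrow> ('a \<Rightarrow> real) set" where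
  "UC_kappa \<kappa> = C_kappa_top \<kappa> closure_of Lip_b"

definition UC_kappa_top :: "('a::metric_space \<Rightarrow> real) \<Rightarrow> ('a \<Rightarrow> real) topology" where
  "UC_kappa_top \<kappa> = subtopology (C_kappa_top \<kappa>) (UC_kappa \<kappa>)"

lemma kappa_norm_add_le:
  "kappa_norm \<kappa> (\<lambda>x. u x + v x) \<le> kappa_norm \<kappa> u + kappa_norm \<kappa> v"
  unfolding kappa_norm_def sup_norm_def
proof (rule SUP_least)
  fix x
  have "ennreal \<bar>\<kappa> x * (u x + v x)\<bar> \<le> ennreal \<bar>\<kappa> x * u x\<bar> + ennreal \<bar>\<kappa> x * v x\<bar>"
    by (simp add: distrib_left abs_triangle_ineq ennreal_leI flip: ennreal_plus)
  also have "\<dots> \<le> (SUP x. ennreal \<bar>\<kappa> x * u x\<bar>) + (SUP x. ennreal \<bar>\<kappa> x * v x\<bar>)"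
    by (intro add_mono SUP_upper) auto
  finally show "ennreal \<bar>\<kappa> x * (u x + v x)\<bar>
    \<le> (SUP x. ennreal \<bar>\<kappa> x * u x\<bar>) + (SUP x. ennreal \<bar>\<kappa> x * v x\<bar>)" .
qed

lemma kappa_norm_minus_commute:
  "kappa_norm \<kappa> (\<lambda>x. u x - v x) = kappa_norm \<kappa> (\<lambda>x. v x - u x)"
  by (simp add: kappa_norm_def sup_norm_def abs_mult abs_minus_commute)

lemma kappa_norm_eq_0_iff:
  assumes "\<And>x. \<kappa> x > 0"
  shows "kappa_norm \<kappa> u = 0 \<longleftrightarrow> (\<forall>x. u x = 0)"
proof -
  have "kappa_norm \<kappa> u = 0 \<longleftrightarrow> (\<forall>x. ennreal \<bar>\<kappa> x * u x\<bar> = 0)"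
    unfolding kappa_norm_def sup_norm_def by (subst SUP_eq_iff) auto
  also have "\<dots> \<longleftrightarrow> (\<forall>x. u x = 0)"
    using assms by (auto simp: less_imp_neq[symmetric])
  finally show ?thesis .
qed

lemma kappa_norm_diff_finite:
  assumes "u \<in> C_kappa \<kappa>" "v \<in> C_kappa \<kappa>"
  shows "kappa_norm \<kappa> (\<lambda>x. u x - v x) < \<infinity>"
proof -
  have "kappa_norm \<kappa> (\<lambda>x. - v x) = kappa_norm \<kappa> v"
    by (simp add: kappa_norm_def sup_norm_def)
  with kappa_norm_add_le[of \<kappa> u "\<lambda>x. - v x"] assms show ?thesis
    by (auto simp: C_kappa_def intro: le_less_trans)
qed

lemma Metric_space_C_kappa:
  fixes \<kappa> :: "'a::metric_space \<Rightarrow> real"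
  assumes "\<And>x. \<kappa> x > 0"
  shows "Metric_space (C_kappa \<kappa>) (kappa_dist \<kappa>)"
proof
  fix u v w :: "'a \<Rightarrow> real"
  show "0 \<le> kappa_dist \<kappa> u v" by (simp add: kappa_dist_def)
  show "kappa_dist \<kappa> u v = kappa_dist \<kappa> v u"
    by (simp add: kappa_dist_def kappa_norm_minus_commute[of \<kappa> u v])
  assume u: "u \<in> C_kappa \<kappa>" and v: "v \<in> C_kappa \<kappa>"
  show "kappa_dist \<kappa> u v = 0 \<longleftrightarrow> u = v"
    using kappa_norm_diff_finite[OF u v] kappa_norm_eq_0_iff[OF assms, where u = "\<lambda>x. u x - v x"]
    by (auto simp: kappa_dist_def enn2real_eq_0_iff fun_eq_iff)
  assume w: "w \<in> C_kappa \<kappa>"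
  have "enn2real (kappa_norm \<kappa> (\<lambda>x. u x - w x))
    \<le> enn2real (kappa_norm \<kappa> (\<lambda>x. u x - v x) + kappa_norm \<kappa> (\<lambda>x. v x - w x))"
    using kappa_norm_add_le[of \<kappa> "\<lambda>x. u x - v x" "\<lambda>x. v x - w x"]
      kappa_norm_diff_finite[OF u v] kappa_norm_diff_finite[OF v w]
    by (intro enn2real_mono) auto
  also have "\<dots> = enn2real (kappa_norm \<kappa> (\<lambda>x. u x - v x))
      + enn2real (kappa_norm \<kappa> (\<lambda>x. v x - w x))"
    using kappa_norm_diff_finite[OF u v] kappa_norm_diff_finite[OF v w]
    by (intro enn2real_plus) auto
  finally show "kappa_dist \<kappa> u w \<le> kappa_dist \<kappa> u v + kappa_dist \<kappa> v w"
    by (simp add: kappa_dist_def)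
qed

section \<open>Feller semigroups\<close>

definition increases_to ::
  "('a::metric_space \<Rightarrow> real) \<Rightarrow> (nat \<Rightarrow> 'a \<Rightarrow> real) \<Rightarrow> ('a \<Rightarrow> real) \<Rightarrow> bool" where
  "increases_to \<kappa> us u \<longleftrightarrow>
     (\<forall>n. us n \<in> UC_kappa \<kappa>) \<and> u \<in> UC_kappa \<kappa> \<and>
     (\<forall>n. us n \<le> us (Suc n)) \<and> (\<forall>x. (\<lambda>n. us n x) \<longlonglongrightarrow> u x)"

text \<open>Operators on \<open>UC_kappa \<kappa>\<close> are represented by functions defined on all of
  \<open>'a \<Rightarrow> real\<close>; their values outside \<open>UC_kappa \<kappa>\<close> and at negative times are irrelevant.
  That \<open>T t\<close> maps \<open>UC_kappa \<kappa>\<close> into itself is part of \<open>continuous_map\<close>.\<close>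

definition Feller_semigroup ::
  "('a::metric_space \<Rightarrow> real) \<Rightarrow> (real \<Rightarrow> ('a \<Rightarrow> real) \<Rightarrow> ('a \<Rightarrow> real)) \<Rightarrow> bool" where
  "Feller_semigroup \<kappa> T \<longleftrightarrow>
     (\<forall>t\<ge>0. continuous_map (UC_kappa_top \<kappa>) (UC_kappa_top \<kappa>) (T t)) \<and>
     (\<forall>u\<in>UC_kappa \<kappa>. T 0 u = u) \<and>
     (\<forall>s\<ge>0. \<forall>t\<ge>0. \<forall>u\<in>UC_kappa \<kappa>. T (s + t) u = T s (T t u)) \<and>
     (\<forall>t\<ge>0. \<forall>u\<in>UC_kappa \<kappa>. \<forall>v\<in>UC_kappa \<kappa>. u \<le> v \<longrightarrow> T t u \<le> T t v) \<and>
     (\<forall>t\<ge>0. \<forall>us u. increases_to \<kappa> us u \<longrightarrow> increases_to \<kappa> (\<lambda>n. T t (us n)) (T t u))"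

definition linear_operator ::
  "('a::metric_space \<Rightarrow> real) \<Rightarrow> (('a \<Rightarrow> real) \<Rightarrow> ('a \<Rightarrow> real)) \<Rightarrow> bool" where
  "linear_operator \<kappa> A \<longleftrightarrow>
     (\<forall>u\<in>UC_kappa \<kappa>. \<forall>v\<in>UC_kappa \<kappa>. \<forall>a b.
        A (\<lambda>x. a * u x + b * v x) = (\<lambda>x. a * A u x + b * A v x))"

section \<open>Partitions and the semigroup envelope\<close>

text \<open>The suprema below are suprema of reals. Under the growth bounds
  \<open>kappa_norm \<kappa> (S l t u) \<le> exp (\<alpha> * t) * kappa_norm \<kappa> u\<close> the families are bounded at every
  point whenever \<open>u \<in> UC_kappa \<kappa>\<close>.\<close>

definition sup_operator ::
  "'l set \<Rightarrow> ('l \<Rightarrow> real \<Rightarrow> ('a \<Rightarrow> real) \<Rightarrow> ('a \<Rightarrow> real)) \<Rightarrow>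
   real \<Rightarrow> ('a \<Rightarrow> real) \<Rightarrow> ('a \<Rightarrow> real)" where
  "sup_operator \<Lambda> S h u = (\<lambda>x. SUP l\<in>\<Lambda>. S l h u x)"

definition partitions :: "real set set" where
  "partitions = {\<pi>. finite \<pi> \<and> \<pi> \<subseteq> {0..} \<and> 0 \<in> \<pi>}"

definition partitions_upto :: "real \<Rightarrow> real set set" where
  "partitions_upto t = {\<pi> \<in> partitions. Max \<pi> = t}"

definition mesh :: "real set \<Rightarrow> real" where
  "mesh \<pi> = (let ts = sorted_list_of_set \<pi> in
     if \<pi> = {0} then 0 else Max ((\<lambda>j. ts ! j - ts ! (j - 1)) ` {1..<length ts}))"

fun step_composition ::
  "(real \<Rightarrow> ('a \<Rightarrow> real) \<Rightarrow> ('a \<Rightarrow> real)) \<Rightarrow> real list \<Rightarrow> ('a \<Rightarrow> real) \<Rightarrow> ('a \<Rightarrow> real)" where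
  "step_composition E (s # t # ts) u = E (t - s) (step_composition E (t # ts) u)"
| "step_composition E [t] u = u"
| "step_composition E [] u = u"

definition partition_operator ::
  "'l set \<Rightarrow> ('l \<Rightarrow> real \<Rightarrow> ('a \<Rightarrow> real) \<Rightarrow> ('a \<Rightarrow> real)) \<Rightarrow>
   real set \<Rightarrow> ('a \<Rightarrow> real) \<Rightarrow> ('a \<Rightarrow> real)" where
  "partition_operator \<Lambda> S \<pi> u = step_composition (sup_operator \<Lambda> S) (sorted_list_of_set \<pi>) u"

definition semigroup_envelope ::
  "'l set \<Rightarrow> ('l \<Rightarrow> real \<Rightarrow> ('a \<Rightarrow> real) \<Rightarrow> ('a \<Rightarrow> real)) \<Rightarrow>
   real \<Rightarrow> ('a \<Rightarrow> real) \<Rightarrow> ('a \<Rightarrow> real)" where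
  "semigroup_envelope \<Lambda> S t u = (\<lambda>x. SUP \<pi>\<in>partitions_upto t. partition_operator \<Lambda> S \<pi> u x)"

end

theory Submission
  imports Defs
begin

text \<open>
  Write \<open>E h\<close> for the pointwise supremum of the operators \<open>S l h\<close> over \<open>l\<close>. Since a product
  \<open>E s \<circ> E t\<close> may switch between semigroups at time \<open>s\<close>, it dominates \<open>E (s + t)\<close>, and therefore
  a finer partition has the larger partition operator (\<open>step_refine\<close>). Along nested partitions
  the partition operators thus increase, and they stay below the envelope by its definition.

  The point is that no other partition \<open>\<rho>\<close> does better than the supremum along the given sequence
  (\<open>partition_operator_le_SUP\<close>). Round the times of \<open>\<rho>\<close> down to the \<open>n\<close>-th partition. The rounded
  times form a coarsening of it, so the corresponding product of steps is below its partition
  operator; and as the mesh tends to zero, the rounded times tend to the times of \<open>\<rho>\<close>. It remains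
  that a product of steps depends continuously on its times (\<open>step_limit\<close>). This follows from the
  assumed time continuity of \<open>E\<close> and the Lipschitz estimate with constant \<open>exp (\<alpha> * h)\<close> for \<open>E h\<close> in
  the weighted norm, which comes from linearity of the semigroups and the uniform growth bound.

  The envelope stays in \<open>UC_kappa\<close> (\<open>envelope_UC\<close>): it maps bounded Lipschitz functions to
  bounded Lipschitz functions, because the bounds for partition operators depend on the
  partition only through its total length, and it is Lipschitz in the weighted norm.

  Finally, the iterates of \<open>E (t / n)\<close> are the partition operators of uniform partitions. The
  dyadic ones are nested and become dense, which gives the limit, and with it the supremum.
\<close>

section \<open>Weighted distances\<close>

text \<open>For \<open>e \<ge> 0\<close> this is \<open>kappa_norm \<kappa> (u - v) \<le> e\<close>, written pointwise in the reals, so that no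
  finiteness of the norm has to be carried along and limits can be discussed before they are known
  to lie in \<open>C_kappa\<close>.\<close>

definition kappa_close :: "('a \<Rightarrow> real) \<Rightarrow> real \<Rightarrow> ('a \<Rightarrow> real) \<Rightarrow> ('a \<Rightarrow> real) \<Rightarrow> bool" where
  "kappa_close \<kappa> e u v \<longleftrightarrow> (\<forall>x. \<kappa> x * \<bar>u x - v x\<bar> \<le> e)"

lemma kappa_closeI: "(\<And>x. \<kappa> x * \<bar>u x - v x\<bar> \<le> e) \<Longrightarrow> kappa_close \<kappa> e u v"
  by (simp add: kappa_close_def)

lemma kappa_closeD: "kappa_close \<kappa> e u v \<Longrightarrow> \<kappa> x * \<bar>u x - v x\<bar> \<le> e"
  by (simp add: kappa_close_def)

lemma kappa_close_commute: "kappa_close \<kappa> e u v \<longleftrightarrow> kappa_close \<kappa> e v u"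
  by (simp add: kappa_close_def abs_minus_commute)

lemma kappa_close_mono: "kappa_close \<kappa> d u v \<Longrightarrow> d \<le> e \<Longrightarrow> kappa_close \<kappa> e u v"
  by (auto simp: kappa_close_def intro: order_trans)

text \<open>A finite infimum defining \<open>Lip_norm\<close> is attained, because the inequality
  \<open>dist (u x) (u y) \<le> L' * dist x y\<close> survives letting \<open>L'\<close> decrease to the infimum.\<close>

lemma Lip_norm_leD:
  assumes "Lip_norm u \<le> ennreal L" "L \<ge> 0"
  shows "L-lipschitz_on UNIV u"
proof (rule lipschitz_onI)
  fix x y
  have "dist (u x) (u y) \<le> (L + e) * dist x y" if e: "e > 0" for e
  proof -
    have "(INF L\<in>{L. L-lipschitz_on UNIV u}. ennreal L) < ennreal (L + e)"
      using assms e unfolding Lip_norm_def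
      by (metis add_strict_increasing2 ennreal_less_iff less_add_same_cancel1 order_le_less_trans)
    then obtain L' where L': "L'-lipschitz_on UNIV u" "ennreal L' < ennreal (L + e)"
      unfolding INF_less_iff by auto
    then have "L' \<le> L + e"
      using lipschitz_on_nonneg[OF L'(1)] ennreal_less_iff less_imp_le by blast
    then have "L' * dist x y \<le> (L + e) * dist x y" by (simp add: mult_right_mono)
    with lipschitz_onD[OF L'(1), of x y] show ?thesis by auto
  qed
  then have "\<forall>\<^sub>F e in at_right 0. dist (u x) (u y) \<le> (L + e) * dist x y"
    by (auto simp: eventually_at_right_less intro: eventually_mono[OF eventually_at_right_less])
  moreover have "((\<lambda>e. (L + e) * dist x y) \<longlongrightarrow> (L + 0) * dist x y) (at_right 0)"
    by (intro tendsto_intros)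
  ultimately show "dist (u x) (u y) \<le> L * dist x y"
    using tendsto_lowerbound[of "\<lambda>e. (L + e) * dist x y" _ "at_right (0::real)"] by simp
qed (use assms in auto)

lemma Lip_norm_le:
  assumes "L-lipschitz_on UNIV u"
  shows "Lip_norm u \<le> ennreal L"
  unfolding Lip_norm_def by (rule INF_lower2[of L]) (use assms in auto)

lemma Lip_b_iff: "u \<in> Lip_b \<longleftrightarrow> (\<exists>c. \<forall>x. \<bar>u x\<bar> \<le> c) \<and> (\<exists>L. L-lipschitz_on UNIV u)"
  by (auto simp: Lip_b_def bounded_iff)

lemma Lip_bI: "(\<And>x. \<bar>u x\<bar> \<le> c) \<Longrightarrow> L-lipschitz_on UNIV u \<Longrightarrow> u \<in> Lip_b"
  by (auto simp: Lip_b_iff)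

lemma Lip_b_const: "(\<lambda>x. c) \<in> Lip_b"
  by (auto simp: Lip_b_def intro: lipschitz_on_constant)

text \<open>Suprema are nonexpansive in the uniform distance of the families. Taken at one point for two
  functions, this carries weighted estimates over to a supremum of operators; taken at two points
  for one function, it carries Lipschitz constants over.\<close>

lemma abs_SUP_diff_le:
  fixes f g :: "'i \<Rightarrow> real"
  assumes "I \<noteq> {}" "bdd_above (f ` I)" "bdd_above (g ` I)"
    and le: "\<And>i. i \<in> I \<Longrightarrow> \<bar>f i - g i\<bar> \<le> c"
  shows "\<bar>(SUP i\<in>I. f i) - (SUP i\<in>I. g i)\<bar> \<le> c"
proof -
  have "(SUP i\<in>I. f i) \<le> (SUP i\<in>I. g i) + c"
  proof (rule cSUP_least[OF assms(1)])
    fix i assume "i \<in> I"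
    with cSUP_upper[OF this assms(3)] le[OF this] show "f i \<le> (SUP i\<in>I. g i) + c" by linarith
  qed
  moreover have "(SUP i\<in>I. g i) \<le> (SUP i\<in>I. f i) + c"
  proof (rule cSUP_least[OF assms(1)])
    fix i assume "i \<in> I"
    with cSUP_upper[OF this assms(2)] le[OF this] show "g i \<le> (SUP i\<in>I. f i) + c" by linarith
  qed
  ultimately show ?thesis by linarith
qed

locale weight_function =
  fixes \<kappa> :: "'a::metric_space \<Rightarrow> real"
  assumes continuous_weight: "continuous_on UNIV \<kappa>"
    and bounded_weight: "bounded (range \<kappa>)"
    and weight_pos: "\<And>x. \<kappa> x > 0"
begin

sublocale C: Metric_space "C_kappa \<kappa>" "kappa_dist \<kappa>"
  by (rule Metric_space_C_kappa[OF weight_pos])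

lemma kappa_norm_le_iff:
  assumes "c \<ge> 0"
  shows "kappa_norm \<kappa> u \<le> ennreal c \<longleftrightarrow> (\<forall>x. \<kappa> x * \<bar>u x\<bar> \<le> c)"
  using assms weight_pos
  by (simp add: kappa_norm_def sup_norm_def SUP_le_iff abs_mult less_imp_le)

lemma kappa_dist_le_iff:
  assumes "u \<in> C_kappa \<kappa>" "v \<in> C_kappa \<kappa>" "c \<ge> 0"
  shows "kappa_dist \<kappa> u v \<le> c \<longleftrightarrow> kappa_close \<kappa> c u v"
proof -
  have "kappa_dist \<kappa> u v \<le> c \<longleftrightarrow> kappa_norm \<kappa> (\<lambda>x. u x - v x) \<le> ennreal c"
    using kappa_norm_diff_finite[OF assms(1,2)] assms(3) unfolding kappa_dist_def
    by (metis enn2real_leI ennreal_enn2real ennreal_leI infinity_ennreal_def)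
  then show ?thesis using kappa_norm_le_iff[OF assms(3)] by (simp add: kappa_close_def)
qed

lemma C_kappa_iff:
  "u \<in> C_kappa \<kappa> \<longleftrightarrow> continuous_on UNIV u \<and> (\<exists>c\<ge>0. \<forall>x. \<kappa> x * \<bar>u x\<bar> \<le> c)"
proof -
  have "kappa_norm \<kappa> u < \<infinity> \<longleftrightarrow> (\<exists>c\<ge>0. kappa_norm \<kappa> u \<le> ennreal c)"
    by (metis ennreal_enn2real enn2real_nonneg ennreal_less_top infinity_ennreal_def
        le_less_trans order_refl)
  then show ?thesis using kappa_norm_le_iff by (auto simp: C_kappa_def)
qed

lemma kappa_close_triangle:
  assumes "kappa_close \<kappa> c u v" "kappa_close \<kappa> d v w"
  shows "kappa_close \<kappa> (c + d) u w"
proof (rule kappa_closeI)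
  fix x
  have "\<kappa> x * \<bar>u x - w x\<bar> \<le> \<kappa> x * (\<bar>u x - v x\<bar> + \<bar>v x - w x\<bar>)"
    using weight_pos[of x] by (intro mult_left_mono) auto
  also have "\<dots> \<le> c + d" using assms by (simp add: distrib_left add_mono kappa_closeD)
  finally show "\<kappa> x * \<bar>u x - w x\<bar> \<le> c + d" .
qed

lemma kappa_close_SUP:
  assumes "I \<noteq> {}" "\<And>x. bdd_above ((\<lambda>i. f i x) ` I)" "\<And>x. bdd_above ((\<lambda>i. g i x) ` I)"
    and "\<And>i. i \<in> I \<Longrightarrow> kappa_close \<kappa> c (f i) (g i)"
  shows "kappa_close \<kappa> c (\<lambda>x. SUP i\<in>I. f i x) (\<lambda>x. SUP i\<in>I. g i x)"
proof (rule kappa_closeI)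
  fix x
  have "\<bar>(SUP i\<in>I. f i x) - (SUP i\<in>I. g i x)\<bar> \<le> c / \<kappa> x"
    using assms weight_pos[of x] by (intro abs_SUP_diff_le) (auto simp: field_simps kappa_close_def)
  then show "\<kappa> x * \<bar>(SUP i\<in>I. f i x) - (SUP i\<in>I. g i x)\<bar> \<le> c"
    using weight_pos[of x] by (simp add: field_simps)
qed

lemma Lip_b_C_kappa: "u \<in> Lip_b \<Longrightarrow> u \<in> C_kappa \<kappa>"
proof -
  assume u: "u \<in> Lip_b"
  then obtain c L where c: "\<And>x. \<bar>u x\<bar> \<le> c" and L: "L-lipschitz_on UNIV u"
    by (auto simp: Lip_b_def bounded_iff)
  obtain k where k: "\<And>x. \<bar>\<kappa> x\<bar> \<le> k" using bounded_weight by (auto simp: bounded_iff)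
  have "\<kappa> x * \<bar>u x\<bar> \<le> k * c" for x
    using k[of x] c[of x] weight_pos[of x] by (intro mult_mono) auto
  moreover have "k * c \<ge> 0"
    using k[of undefined] c[of undefined] by (meson abs_ge_zero mult_nonneg_nonneg order_trans)
  ultimately show ?thesis
    using lipschitz_on_continuous_on[OF L] by (auto simp: C_kappa_iff)
qed

text \<open>A limit in the weighted distance is continuous, since \<open>\<kappa> * u\<close> is a uniform limit of
  continuous functions and \<open>\<kappa>\<close> can be divided out.\<close>

lemma C_kappa_closed:
  assumes "\<And>e. e > 0 \<Longrightarrow> \<exists>v\<in>C_kappa \<kappa>. kappa_close \<kappa> e u v"
  shows "u \<in> C_kappa \<kappa>"
proof -
  obtain w where w: "w n \<in> C_kappa \<kappa>" "kappa_close \<kappa> (inverse (Suc n)) u (w n)" for n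
    using assms[of "inverse (real (Suc _))"] by (metis inverse_positive_iff_positive of_nat_0_less_iff zero_less_Suc)
  have "uniform_limit UNIV (\<lambda>n x. \<kappa> x * w n x) (\<lambda>x. \<kappa> x * u x) sequentially"
  proof (rule uniform_limitI)
    fix e :: real assume "e > 0"
    then have "\<forall>\<^sub>F n in sequentially. inverse (real (Suc n)) < e"
      using LIMSEQ_inverse_real_of_nat by (simp add: order_tendstoD)
    then show "\<forall>\<^sub>F n in sequentially. \<forall>x\<in>UNIV. dist (\<kappa> x * w n x) (\<kappa> x * u x) < e"
    proof eventually_elim
      case (elim n)
      show ?case
      proof
        fix x
        have "dist (\<kappa> x * w n x) (\<kappa> x * u x) = \<kappa> x * \<bar>u x - w n x\<bar>"
          using weight_pos[of x]
          by (simp add: dist_real_def abs_minus_commute abs_mult flip: right_diff_distrib)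
        also have "\<dots> \<le> inverse (real (Suc n))" by (rule kappa_closeD[OF w(2)])
        finally show "dist (\<kappa> x * w n x) (\<kappa> x * u x) < e" using elim by linarith
      qed
    qed
  qed
  then have "continuous_on UNIV (\<lambda>x. \<kappa> x * u x)"
    using w(1) by (intro uniform_limit_theorem[where F = sequentially])
      (auto simp: C_kappa_iff intro!: always_eventually continuous_intros continuous_weight)
  then have "continuous_on UNIV (\<lambda>x. \<kappa> x * u x / \<kappa> x)"
    using weight_pos
    by (intro continuous_on_divide continuous_weight) (auto simp: less_imp_neq[symmetric])
  moreover have "(\<lambda>x. \<kappa> x * u x / \<kappa> x) = u"
    using weight_pos by (auto simp: fun_eq_iff less_imp_neq[symmetric])
  ultimately have "continuous_on UNIV u" by (simp only:)
  moreover obtain c where c: "c \<ge> 0" "\<forall>x. \<kappa> x * \<bar>w 0 x\<bar> \<le> c"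
    using w(1)[of 0] by (auto simp: C_kappa_iff)
  have "\<forall>x. \<kappa> x * \<bar>u x\<bar> \<le> 1 + c"
    using kappa_close_triangle[of 1 u "w 0" c "\<lambda>_. 0"] w(2)[of 0] c(2)
    by (simp add: kappa_close_def)
  ultimately show ?thesis using c(1) by (auto simp: C_kappa_iff intro!: exI[of _ "1 + c"])
qed

text \<open>The topological closure within \<open>C_kappa\<close> in elementary form. That \<open>u\<close> itself lies in
  \<open>C_kappa\<close> comes out of the approximation.\<close>

lemma UC_kappa_iff: "u \<in> UC_kappa \<kappa> \<longleftrightarrow> (\<forall>e>0. \<exists>v\<in>Lip_b. kappa_close \<kappa> e u v)"
proof
  assume "u \<in> UC_kappa \<kappa>"
  then have u: "u \<in> C_kappa \<kappa>" and "\<And>e. e > 0 \<Longrightarrow> \<exists>v\<in>Lip_b. v \<in> C_kappa \<kappa> \<and> kappa_dist \<kappa> u v < e"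
    by (auto simp: UC_kappa_def C_kappa_top_def C.metric_closure_of)
  then show "\<forall>e>0. \<exists>v\<in>Lip_b. kappa_close \<kappa> e u v"
    by (meson kappa_dist_le_iff less_imp_le)
next
  assume *: "\<forall>e>0. \<exists>v\<in>Lip_b. kappa_close \<kappa> e u v"
  then have u: "u \<in> C_kappa \<kappa>" using Lip_b_C_kappa by (intro C_kappa_closed) blast
  have "\<exists>v\<in>Lip_b. v \<in> C_kappa \<kappa> \<and> kappa_dist \<kappa> u v < e" if e: "e > 0" for e
  proof -
    obtain v where v: "v \<in> Lip_b" "kappa_close \<kappa> (e/2) u v" using * e by (meson half_gt_zero)
    then have "kappa_dist \<kappa> u v \<le> e/2"
      using kappa_dist_le_iff[OF u Lip_b_C_kappa[OF v(1)], of "e/2"] e by simp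
    then show ?thesis using v e Lip_b_C_kappa by force
  qed
  then show "u \<in> UC_kappa \<kappa>"
    using u by (auto simp: UC_kappa_def C_kappa_top_def C.metric_closure_of)
qed

lemma UC_C_kappa: "u \<in> UC_kappa \<kappa> \<Longrightarrow> u \<in> C_kappa \<kappa>"
  unfolding UC_kappa_iff using Lip_b_C_kappa by (intro C_kappa_closed) blast

lemma Lip_b_UC: "u \<in> Lip_b \<Longrightarrow> u \<in> UC_kappa \<kappa>"
  unfolding UC_kappa_iff by (auto simp: kappa_close_def intro!: bexI[of _ u])

lemma UC_closed:
  assumes "\<And>e. e > 0 \<Longrightarrow> \<exists>v\<in>UC_kappa \<kappa>. kappa_close \<kappa> e u v"
  shows "u \<in> UC_kappa \<kappa>"
  unfolding UC_kappa_iff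
proof (intro allI impI)
  fix e :: real assume "e > 0"
  then obtain v w where "kappa_close \<kappa> (e/2) u v" "w \<in> Lip_b" "kappa_close \<kappa> (e/2) v w"
    using assms[of "e/2"] UC_kappa_iff by (meson half_gt_zero)
  then show "\<exists>v\<in>Lip_b. kappa_close \<kappa> e u v"
    using kappa_close_triangle[of "e/2" u v "e/2" w] by auto
qed

lemma UC_diff:
  assumes "u \<in> UC_kappa \<kappa>" "v \<in> UC_kappa \<kappa>"
  shows "(\<lambda>x. u x - v x) \<in> UC_kappa \<kappa>"
  unfolding UC_kappa_iff
proof (intro allI impI)
  fix e :: real assume "e > 0"
  then obtain p q where p: "p \<in> Lip_b" "kappa_close \<kappa> (e/2) u p"
    and q: "q \<in> Lip_b" "kappa_close \<kappa> (e/2) v q"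
    using assms UC_kappa_iff by (meson half_gt_zero)
  obtain a b L M where "\<And>x. \<bar>p x\<bar> \<le> a" "\<And>x. \<bar>q x\<bar> \<le> b" "L-lipschitz_on UNIV p" "M-lipschitz_on UNIV q"
    using p(1) q(1) by (auto simp: Lip_b_iff)
  then have "(\<lambda>x. p x - q x) \<in> Lip_b"
    unfolding Lip_b_iff
    by (blast intro: lipschitz_on_diff order_trans[OF abs_triangle_ineq4] add_mono)
  moreover have "kappa_close \<kappa> e (\<lambda>x. u x - v x) (\<lambda>x. p x - q x)"
  proof (rule kappa_closeI)
    fix x
    have "\<kappa> x * \<bar>u x - v x - (p x - q x)\<bar> \<le> \<kappa> x * (\<bar>u x - p x\<bar> + \<bar>v x - q x\<bar>)"
      using weight_pos[of x] by (intro mult_left_mono) auto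
    also have "\<dots> \<le> e / 2 + e / 2" using p(2) q(2) by (simp only: distrib_left) (intro add_mono kappa_closeD)
    finally show "\<kappa> x * \<bar>u x - v x - (p x - q x)\<bar> \<le> e" by simp
  qed
  ultimately show "\<exists>v'\<in>Lip_b. kappa_close \<kappa> e (\<lambda>x. u x - v x) v'" by blast
qed

lemma topspace_UC [simp]: "topspace (UC_kappa_top \<kappa>) = UC_kappa \<kappa>"
  using UC_C_kappa by (auto simp: UC_kappa_top_def C_kappa_top_def)

lemma limitin_UC_iff:
  assumes "v \<in> UC_kappa \<kappa>" "\<And>n. w n \<in> UC_kappa \<kappa>"
  shows "limitin (UC_kappa_top \<kappa>) w v sequentially
     \<longleftrightarrow> (\<forall>e>0. \<forall>\<^sub>F n in sequentially. kappa_close \<kappa> e (w n) v)"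
proof -
  have C: "v \<in> C_kappa \<kappa>" "w n \<in> C_kappa \<kappa>" for n using assms UC_C_kappa by auto
  have "limitin (UC_kappa_top \<kappa>) w v sequentially
     \<longleftrightarrow> (\<forall>e>0. \<forall>\<^sub>F n in sequentially. kappa_dist \<kappa> (w n) v < e)"
    using assms C by (simp add: UC_kappa_top_def C_kappa_top_def limitin_subtopology C.limitin_metric)
  also have "\<dots> \<longleftrightarrow> (\<forall>e>0. \<forall>\<^sub>F n in sequentially. kappa_dist \<kappa> (w n) v \<le> e)"
  proof safe
    fix e :: real
    assume *: "\<forall>e>0. \<forall>\<^sub>F n in sequentially. kappa_dist \<kappa> (w n) v \<le> e" and "e > 0"
    then have "\<forall>\<^sub>F n in sequentially. kappa_dist \<kappa> (w n) v \<le> e / 2"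
      using half_gt_zero by blast
    then show "\<forall>\<^sub>F n in sequentially. kappa_dist \<kappa> (w n) v < e"
      by (rule eventually_mono) (use \<open>e > 0\<close> in simp)
  qed (auto elim!: eventually_mono)
  also have "\<dots> \<longleftrightarrow> (\<forall>e>0. \<forall>\<^sub>F n in sequentially. kappa_close \<kappa> e (w n) v)"
    using C by (simp add: kappa_dist_le_iff)
  finally show ?thesis .
qed

end

section \<open>Suprema of linear Feller semigroups\<close>

locale Feller_family = weight_function \<kappa>
  for \<kappa> :: "'a::metric_space \<Rightarrow> real" +
  fixes \<Lambda> :: "'l set"
    and S :: "'l \<Rightarrow> real \<Rightarrow> ('a \<Rightarrow> real) \<Rightarrow> ('a \<Rightarrow> real)"
    and \<alpha> \<beta> :: real
  assumes nonempty: "\<Lambda> \<noteq> {}"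
    and Feller: "\<And>l. l \<in> \<Lambda> \<Longrightarrow> Feller_semigroup \<kappa> (S l)"
    and linear: "\<And>l s. l \<in> \<Lambda> \<Longrightarrow> s \<ge> 0 \<Longrightarrow> linear_operator \<kappa> (S l s)"
    and unit: "\<And>l s. l \<in> \<Lambda> \<Longrightarrow> s \<ge> 0 \<Longrightarrow> S l s (\<lambda>x. 1) = (\<lambda>x. 1)"
    and growth: "\<And>l s u. l \<in> \<Lambda> \<Longrightarrow> s \<ge> 0 \<Longrightarrow> u \<in> Lip_b \<Longrightarrow>
      kappa_norm \<kappa> (S l s u) \<le> ennreal (exp (\<alpha> * s)) * kappa_norm \<kappa> u"
    and Lip_growth: "\<And>l s u. l \<in> \<Lambda> \<Longrightarrow> s \<ge> 0 \<Longrightarrow> u \<in> Lip_b \<Longrightarrow>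
      Lip_norm (S l s u) \<le> ennreal (exp (\<beta> * s)) * Lip_norm u"
    and time_cont: "\<And>u. u \<in> UC_kappa \<kappa> \<Longrightarrow>
      continuous_map (top_of_set {0..}) (UC_kappa_top \<kappa>) (\<lambda>h. sup_operator \<Lambda> S h u)"
begin

text \<open>Written \<open>E h\<close>, the supremum of the semigroups plays the role of a one-step operator: it is
  monotone, the identity for \<open>h = 0\<close>, and only subadditive in time, \<open>E (s + t) \<le> E s \<circ> E t\<close>,
  so that inserting intermediate times can only increase a product of steps.\<close>

abbreviation "E \<equiv> sup_operator \<Lambda> S"

context
  fixes l s assumes l: "l \<in> \<Lambda>" and s: "(s::real) \<ge> 0"
begin

lemma semigroup_continuous: "continuous_map (UC_kappa_top \<kappa>) (UC_kappa_top \<kappa>) (S l s)"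
  using Feller[OF l] s by (simp add: Feller_semigroup_def)

lemma semigroup_UC: "u \<in> UC_kappa \<kappa> \<Longrightarrow> S l s u \<in> UC_kappa \<kappa>"
  using continuous_map_image_subset_topspace[OF semigroup_continuous] by auto

lemma semigroup_mono:
  "u \<in> UC_kappa \<kappa> \<Longrightarrow> v \<in> UC_kappa \<kappa> \<Longrightarrow> u \<le> v \<Longrightarrow> S l s u \<le> S l s v"
  using Feller[OF l] s by (simp add: Feller_semigroup_def)

lemma semigroup_diff:
  assumes "u \<in> UC_kappa \<kappa>" "v \<in> UC_kappa \<kappa>"
  shows "S l s (\<lambda>x. u x - v x) = (\<lambda>x. S l s u x - S l s v x)"
proof -
  have "S l s (\<lambda>x. 1 * u x + (-1) * v x) = (\<lambda>x. 1 * S l s u x + (-1) * S l s v x)"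
    using linear[OF l s] assms unfolding linear_operator_def by blast
  then show ?thesis by simp
qed

lemma semigroup_const: "S l s (\<lambda>x. c) = (\<lambda>x. c)"
proof -
  have 1: "(\<lambda>x. 1) \<in> UC_kappa \<kappa>" by (rule Lip_b_UC[OF Lip_b_const])
  from linear[OF l s, unfolded linear_operator_def, rule_format, OF 1 1, of c 0]
  show ?thesis by (simp add: unit[OF l s])
qed

lemma semigroup_Lipschitz:
  assumes u: "u \<in> Lip_b" and L: "L-lipschitz_on UNIV u"
  shows "(exp (\<beta> * s) * L)-lipschitz_on UNIV (S l s u)"
proof (rule Lip_norm_leD)
  have "Lip_norm (S l s u) \<le> ennreal (exp (\<beta> * s)) * ennreal L"
    using Lip_growth[OF l s u] Lip_norm_le[OF L] by (meson mult_left_mono order_trans zero_le)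
  then show "Lip_norm (S l s u) \<le> ennreal (exp (\<beta> * s) * L)"
    by (simp add: ennreal_mult' )
qed (use lipschitz_on_nonneg[OF L] in simp)

text \<open>Density of \<open>Lip_b\<close> and continuity of \<open>S l s\<close>, combined into one approximant that is good
  both before and after applying the operator.\<close>

lemma semigroup_approx:
  assumes u: "u \<in> UC_kappa \<kappa>" and e: "e > 0"
  obtains v where "v \<in> Lip_b" "kappa_close \<kappa> e u v" "kappa_close \<kappa> e (S l s u) (S l s v)"
proof -
  have "\<forall>n. \<exists>v\<in>Lip_b. kappa_close \<kappa> (inverse (real (Suc n))) u v"
    using u unfolding UC_kappa_iff by simp
  then obtain w where w: "\<And>n. w n \<in> Lip_b" "\<And>n. kappa_close \<kappa> (inverse (real (Suc n))) u (w n)"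
    by metis
  have "\<forall>\<^sub>F n in sequentially. kappa_close \<kappa> d (w n) u" if d: "d > 0" for d
  proof -
    have "\<forall>\<^sub>F n in sequentially. inverse (real (Suc n)) < d"
      using LIMSEQ_inverse_real_of_nat d by (simp add: order_tendstoD)
    then show ?thesis
    proof (rule eventually_mono)
      fix n assume "inverse (real (Suc n)) < d"
      then show "kappa_close \<kappa> d (w n) u"
        using kappa_close_mono[OF w(2)[of n], of d] by (simp add: kappa_close_commute)
    qed
  qed
  note lim = this
  then have "limitin (UC_kappa_top \<kappa>) w u sequentially"
    using u w(1) by (simp add: limitin_UC_iff Lip_b_UC)
  from continuous_map_limit[OF semigroup_continuous this]
  have "\<forall>\<^sub>F n in sequentially. kappa_close \<kappa> e (S l s (w n)) (S l s u)"
    using e u w(1) by (simp add: limitin_UC_iff Lip_b_UC semigroup_UC)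
  with lim[OF e] have "\<forall>\<^sub>F n in sequentially.
      kappa_close \<kappa> e (w n) u \<and> kappa_close \<kappa> e (S l s (w n)) (S l s u)"
    by (rule eventually_conj)
  then obtain n where "kappa_close \<kappa> e (w n) u" "kappa_close \<kappa> e (S l s (w n)) (S l s u)"
    by (auto simp: eventually_sequentially)
  with that[of "w n"] w(1) show ?thesis by (simp add: kappa_close_commute)
qed

lemma semigroup_kappa_bound_Lip_b:
  assumes v: "v \<in> Lip_b" and c: "c \<ge> 0" "kappa_close \<kappa> c v (\<lambda>_. 0)"
  shows "kappa_close \<kappa> (exp (\<alpha> * s) * c) (S l s v) (\<lambda>_. 0)"
proof -
  have "kappa_norm \<kappa> v \<le> ennreal c"
    using c by (simp add: kappa_norm_le_iff kappa_close_def)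
  then have "kappa_norm \<kappa> (S l s v) \<le> ennreal (exp (\<alpha> * s)) * ennreal c"
    using growth[OF l s v] by (meson mult_left_mono order_trans zero_le)
  then have "kappa_norm \<kappa> (S l s v) \<le> ennreal (exp (\<alpha> * s) * c)"
    by (simp add: ennreal_mult')
  then show ?thesis using c(1) by (simp add: kappa_norm_le_iff kappa_close_def)
qed

text \<open>The growth bound is a hypothesis for \<open>Lip_b\<close> only; it extends to \<open>UC_kappa\<close> by density.\<close>

lemma semigroup_kappa_bound:
  assumes u: "u \<in> UC_kappa \<kappa>" and c: "kappa_close \<kappa> c u (\<lambda>_. 0)"
  shows "kappa_close \<kappa> (exp (\<alpha> * s) * c) (S l s u) (\<lambda>_. 0)"
proof (rule kappa_closeI)
  fix x
  have c0: "c \<ge> 0"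
    using kappa_closeD[OF c, of x] weight_pos[of x] by (meson abs_ge_zero less_imp_le mult_nonneg_nonneg order_trans)
  have *: "\<kappa> x * \<bar>S l s u x\<bar> \<le> e + exp (\<alpha> * s) * (e + c)" if e: "e > 0" for e
  proof -
    obtain v where v: "v \<in> Lip_b" "kappa_close \<kappa> e u v" "kappa_close \<kappa> e (S l s u) (S l s v)"
      using semigroup_approx[OF u e] .
    have "kappa_close \<kappa> (e + c) v (\<lambda>_. 0)"
      using v(2) c by (intro kappa_close_triangle) (simp_all add: kappa_close_commute)
    then have "kappa_close \<kappa> (exp (\<alpha> * s) * (e + c)) (S l s v) (\<lambda>_. 0)"
      using e c0 v(1) by (intro semigroup_kappa_bound_Lip_b) auto
    from kappa_close_triangle[OF v(3) this] show ?thesis by (simp add: kappa_close_def)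
  qed
  have "((\<lambda>e. e + exp (\<alpha> * s) * (e + c)) \<longlongrightarrow> 0 + exp (\<alpha> * s) * (0 + c)) (at_right 0)"
    by (intro tendsto_intros)
  then have "\<kappa> x * \<bar>S l s u x\<bar> \<le> 0 + exp (\<alpha> * s) * (0 + c)"
    by (rule tendsto_lowerbound)
      (auto intro!: eventually_mono[OF eventually_at_right_less[of "0::real"]] *)
  then show "\<kappa> x * \<bar>S l s u x - 0\<bar> \<le> exp (\<alpha> * s) * c" by simp
qed

text \<open>By linearity the bound for \<open>u - v\<close> is a Lipschitz estimate. Its constant does not depend on
  \<open>l\<close>, so the estimate passes to the nonlinear operator \<open>E s\<close>.\<close>

lemma semigroup_kappa_close:
  assumes u: "u \<in> UC_kappa \<kappa>" and v: "v \<in> UC_kappa \<kappa>" and c: "kappa_close \<kappa> c u v"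
  shows "kappa_close \<kappa> (exp (\<alpha> * s) * c) (S l s u) (S l s v)"
  using semigroup_kappa_bound[OF UC_diff[OF u v], of c] c semigroup_diff[OF u v]
  by (simp add: kappa_close_def)

end

lemma UC_kappa_bound:
  assumes "u \<in> UC_kappa \<kappa>"
  obtains c where "kappa_close \<kappa> c u (\<lambda>_. 0)"
  using UC_C_kappa[OF assms] by (auto simp: C_kappa_iff kappa_close_def)

lemma bdd_above_semigroups:
  assumes u: "u \<in> UC_kappa \<kappa>" and s: "s \<ge> 0"
  shows "bdd_above ((\<lambda>l. S l s u x) ` \<Lambda>)"
proof -
  obtain c where c: "kappa_close \<kappa> c u (\<lambda>_. 0)" using UC_kappa_bound[OF u] .
  show ?thesis
  proof (rule bdd_aboveI2)
    fix l assume "l \<in> \<Lambda>"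
    from kappa_closeD[OF semigroup_kappa_bound[OF this s u c], of x]
    have "\<bar>S l s u x\<bar> \<le> exp (\<alpha> * s) * c / \<kappa> x" using weight_pos[of x] by (simp add: field_simps)
    then show "S l s u x \<le> exp (\<alpha> * s) * c / \<kappa> x" by linarith
  qed
qed

lemma semigroup_le_E: "u \<in> UC_kappa \<kappa> \<Longrightarrow> s \<ge> 0 \<Longrightarrow> l \<in> \<Lambda> \<Longrightarrow> S l s u \<le> E s u"
  unfolding sup_operator_def by (intro le_funI cSUP_upper bdd_above_semigroups)

lemma E_le: "(\<And>l. l \<in> \<Lambda> \<Longrightarrow> S l s u \<le> w) \<Longrightarrow> E s u \<le> w"
  unfolding sup_operator_def by (intro le_funI cSUP_least nonempty) (simp add: le_fun_def)

text \<open>Time continuity of \<open>E\<close> takes values in \<open>UC_kappa_top\<close>, hence already contains that \<open>E s\<close>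
  preserves \<open>UC_kappa\<close>.\<close>

lemma E_UC: "u \<in> UC_kappa \<kappa> \<Longrightarrow> s \<ge> 0 \<Longrightarrow> E s u \<in> UC_kappa \<kappa>"
  using continuous_map_image_subset_topspace[OF time_cont] by fastforce

lemma E_mono:
  assumes "u \<in> UC_kappa \<kappa>" "v \<in> UC_kappa \<kappa>" "s \<ge> 0" "u \<le> v"
  shows "E s u \<le> E s v"
  using assms by (intro E_le) (meson order_trans semigroup_mono semigroup_le_E)

lemma E_0: "u \<in> UC_kappa \<kappa> \<Longrightarrow> E 0 u = u"
  using Feller nonempty by (auto simp: sup_operator_def Feller_semigroup_def fun_eq_iff)

lemma E_const: "s \<ge> 0 \<Longrightarrow> E s (\<lambda>_. c) = (\<lambda>_. c)"
  using nonempty by (auto simp: sup_operator_def semigroup_const fun_eq_iff)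

text \<open>The semigroup law of a single \<open>S l\<close> uses the same \<open>l\<close> in both steps; on the right-hand side
  the two indices may be chosen separately, even differently at every point.\<close>

lemma E_add_le:
  assumes u: "u \<in> UC_kappa \<kappa>" and st: "s \<ge> 0" "t \<ge> 0"
  shows "E (s + t) u \<le> E s (E t u)"
proof (rule E_le)
  fix l assume l: "l \<in> \<Lambda>"
  have "S l (s + t) u = S l s (S l t u)"
    using Feller[OF l] u st by (simp add: Feller_semigroup_def)
  also have "\<dots> \<le> S l s (E t u)"
    using l u st by (intro semigroup_mono semigroup_le_E semigroup_UC E_UC)
  also have "\<dots> \<le> E s (E t u)" using l u st by (intro semigroup_le_E E_UC)
  finally show "S l (s + t) u \<le> E s (E t u)" .
qed

lemma E_kappa_close:
  assumes "u \<in> UC_kappa \<kappa>" "v \<in> UC_kappa \<kappa>" "s \<ge> 0" "kappa_close \<kappa> c u v"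
  shows "kappa_close \<kappa> (exp (\<alpha> * s) * c) (E s u) (E s v)"
  unfolding sup_operator_def
  using assms by (intro kappa_close_SUP nonempty bdd_above_semigroups semigroup_kappa_close)

lemma E_Lipschitz:
  assumes L: "L-lipschitz_on UNIV u" and c: "\<And>x. \<bar>u x\<bar> \<le> c" and s: "s \<ge> 0"
  shows "(exp (\<beta> * s) * L)-lipschitz_on UNIV (E s u)"
proof (rule lipschitz_onI)
  fix x y
  have u: "u \<in> Lip_b" using c L by (rule Lip_bI)
  have "\<bar>S l s u x - S l s u y\<bar> \<le> exp (\<beta> * s) * L * dist x y" if "l \<in> \<Lambda>" for l
    using lipschitz_onD[OF semigroup_Lipschitz[OF that s u L], of x y] by (simp add: dist_real_def)
  then show "dist (E s u x) (E s u y) \<le> exp (\<beta> * s) * L * dist x y"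
    unfolding dist_real_def sup_operator_def
    by (intro abs_SUP_diff_le nonempty bdd_above_semigroups Lip_b_UC u s)
qed (use lipschitz_on_nonneg[OF L] in simp)

text \<open>Compare \<open>u\<close> with the constants \<open>c\<close> and \<open>- c\<close>, which \<open>E s\<close> fixes. Together with the
  Lipschitz estimate this keeps bounded Lipschitz functions in a class that is stable under
  pointwise suprema with uniform bounds.\<close>

lemma E_bounded:
  assumes u: "u \<in> UC_kappa \<kappa>" and c: "\<And>x. \<bar>u x\<bar> \<le> c" and s: "s \<ge> 0"
  shows "\<bar>E s u x\<bar> \<le> c"
proof -
  have const: "(\<lambda>x. a) \<in> UC_kappa \<kappa>" for a by (rule Lip_b_UC[OF Lip_b_const])
  have "E s u \<le> E s (\<lambda>x. c)" "E s (\<lambda>x. - c) \<le> E s u"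
    using c by (intro E_mono const u s le_funI; simp add: abs_le_iff minus_le_iff)+
  then show ?thesis using s by (simp add: E_const le_fun_def abs_le_iff minus_le_iff)
qed

lemma E_time_limit:
  assumes u: "u \<in> UC_kappa \<kappa>" and h: "\<And>n. h n \<ge> 0" "h \<longlonglongrightarrow> h0" and e: "e > 0"
  shows "\<forall>\<^sub>F n in sequentially. kappa_close \<kappa> e (E (h n) u) (E h0 u)"
proof -
  have h0: "h0 \<ge> 0" using h by (meson LIMSEQ_le_const)
  have "limitin (top_of_set {0..}) h h0 sequentially"
    using h h0 by (simp add: limitin_subtopology)
  from continuous_map_limit[OF time_cont[OF u] this]
  show ?thesis using e u h h0 by (simp add: limitin_UC_iff E_UC o_def)
qed

section \<open>Products of steps along lists of times\<close>

text \<open>Products of steps are studied along lists that are only weakly increasing. A repeated time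
  contributes the factor \<open>E 0\<close>, which is the identity, so approximating times may coincide
  without harm.\<close>

abbreviation "step \<equiv> step_composition E"

lemma step_UC: "sorted (s # ts) \<Longrightarrow> u \<in> UC_kappa \<kappa> \<Longrightarrow> step (s # ts) u \<in> UC_kappa \<kappa>"
  by (induction ts arbitrary: s) (auto intro: E_UC)

text \<open>The factors \<open>exp (\<alpha> * h)\<close> of the single steps multiply to a constant that depends on the total
  length only. This uniformity over all partitions is what makes the envelope finite and
  Lipschitz in \<open>u\<close>. The same happens to the Lipschitz constants in the next lemma.\<close>

lemma step_kappa_close:
  assumes "sorted (s # ts)" "u \<in> UC_kappa \<kappa>" "v \<in> UC_kappa \<kappa>" "kappa_close \<kappa> c u v"
  shows "kappa_close \<kappa> (exp (\<alpha> * (last (s # ts) - s)) * c) (step (s # ts) u) (step (s # ts) v)"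
  using assms(1)
proof (induction ts arbitrary: s)
  case Nil
  then show ?case using assms by simp
next
  case (Cons t ts)
  have "kappa_close \<kappa> (exp (\<alpha> * (t - s)) * (exp (\<alpha> * (last (t # ts) - t)) * c))
      (E (t - s) (step (t # ts) u)) (E (t - s) (step (t # ts) v))"
    using Cons assms by (intro E_kappa_close step_UC) auto
  also have "exp (\<alpha> * (t - s)) * (exp (\<alpha> * (last (t # ts) - t)) * c)
      = exp (\<alpha> * (last (s # t # ts) - s)) * c"
    by (simp add: algebra_simps flip: exp_add)
  finally show ?case by simp
qed

lemma step_Lipschitz:
  assumes "sorted (s # ts)" "L-lipschitz_on UNIV u" "\<And>x. \<bar>u x\<bar> \<le> c"
  shows "(exp (\<beta> * (last (s # ts) - s)) * L)-lipschitz_on UNIV (step (s # ts) u)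
    \<and> (\<forall>x. \<bar>step (s # ts) u x\<bar> \<le> c)"
  using assms(1)
proof (induction ts arbitrary: s)
  case Nil
  then show ?case using assms by simp
next
  case (Cons t ts)
  let ?v = "step (t # ts) u"
  have v: "(exp (\<beta> * (last (t # ts) - t)) * L)-lipschitz_on UNIV ?v" "\<And>x. \<bar>?v x\<bar> \<le> c"
    using Cons by auto
  have "(exp (\<beta> * (t - s)) * (exp (\<beta> * (last (t # ts) - t)) * L))-lipschitz_on UNIV (E (t - s) ?v)"
    using Cons.prems v by (intro E_Lipschitz) auto
  also have "exp (\<beta> * (t - s)) * (exp (\<beta> * (last (t # ts) - t)) * L)
      = exp (\<beta> * (last (s # t # ts) - s)) * L"
    by (simp add: algebra_simps flip: exp_add)
  finally show ?case
    using Cons.prems v E_bounded[of ?v c "t - s"] Lip_bI[OF v(2) v(1)] Lip_b_UC by simp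
qed

text \<open>Each interval of the coarse list is split at the next time of the fine list by
  \<open>E (s + t) \<le> E s \<circ> E t\<close>. The induction runs on the total length because repeated times may have
  to be dropped from either list.\<close>

lemma step_refine:
  assumes "sorted (a # as)" "sorted (a # bs)" "set as \<subseteq> set (a # bs)"
    and "last (a # as) = last (a # bs)" and u: "u \<in> UC_kappa \<kappa>"
  shows "step (a # as) u \<le> step (a # bs) u"
  using assms(1-4)
proof (induction "length as + length bs" arbitrary: a as bs rule: less_induct)
  case less
  have repeat: "step (a # a # cs) u = step (a # cs) u" if "sorted (a # cs)" for cs
    using that u by (simp add: E_0 step_UC)
  show ?case
  proof (cases as)
    case Nil
    show ?thesis
    proof (cases bs)
      case (Cons b bs')
      have "b \<le> last (a # bs)"
        using less.prems(2) Cons by (cases bs') auto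
      then have "b = a" using less.prems(2,4) Nil Cons by auto
      then show ?thesis
        using less.hyps[of "[]" bs' a] less.prems Nil Cons repeat[of bs'] by (auto split: if_splits)
    qed (use Nil in simp)
  next
    case as: (Cons a' as')
    \<comment> \<open>After dropping repetitions, \<open>as\<close> starts strictly after \<open>a\<close>, so the next fine time \<open>b\<close>
      splits its first step.\<close>
    show ?thesis
    proof (cases "a' = a")
      case True
      then show ?thesis
        using less.hyps[of as' bs a] less.prems as repeat[of as'] by (auto split: if_splits)
    next
      case False
      then have a': "a' > a" using less.prems(1) as by auto
      then obtain b bs' where bs: "bs = b # bs'" using less.prems(3) as by (cases bs) auto
      have sub: "set as \<subseteq> set bs"
        using less.prems(1,3) as a' by fastforce
      then have ba: "b \<le> a'" "a \<le> b" using less.prems(2) as bs by auto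
      have sorted_b: "sorted (b # as)"
        using sub less.prems(1,2) bs by auto
      have IH: "step (b # as) u \<le> step (b # bs') u"
        using less.prems(2,4) as bs sub sorted_b by (intro less.hyps) auto
      have as_UC: "step as u \<in> UC_kappa \<kappa>"
        unfolding as using less.prems(1) as u by (intro step_UC) auto
      have "step (a # as) u = E ((b - a) + (a' - b)) (step as u)" by (simp add: as)
      also have "\<dots> \<le> E (b - a) (E (a' - b) (step as u))"
        using ba as_UC by (intro E_add_le) auto
      also have "\<dots> = E (b - a) (step (b # as) u)" by (simp add: as)
      also have "\<dots> \<le> E (b - a) (step (b # bs') u)"
        using ba u less.prems(2) bs sorted_b IH by (intro E_mono step_UC) auto
      finally show ?thesis by (simp add: bs)
    qed
  qed
qed

text \<open>Products of steps depend continuously on their times. In each factor the argument and the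
  step length move simultaneously: the Lipschitz estimate for \<open>E\<close>, uniform for bounded step
  lengths, controls the argument, and time continuity at the fixed limiting argument controls
  the step length.\<close>

lemma step_limit:
  assumes "sorted (a # as)" "\<And>n. sorted (map (r n) (a # as))"
    and "\<And>s. s \<in> set (a # as) \<Longrightarrow> (\<lambda>n. r n s) \<longlonglongrightarrow> s"
    and u: "u \<in> UC_kappa \<kappa>" and "e > 0"
  shows "\<forall>\<^sub>F n in sequentially. kappa_close \<kappa> e (step (map (r n) (a # as)) u) (step (a # as) u)"
  using assms(1-3,5)
proof (induction as arbitrary: a e)
  case Nil
  then show ?case by (simp add: kappa_close_def)
next
  case (Cons b bs)
  let ?v = "step (b # bs) u" and ?w = "\<lambda>n. step (map (r n) (b # bs)) u"
  let ?h = "\<lambda>n. r n b - r n a"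
  \<comment> \<open>An eventual bound for the Lipschitz constants of the operators \<open>E (?h n)\<close>.\<close>
  define K where "K = exp (\<alpha> * (b - a)) + 1"
  have K: "K > 0" unfolding K_def by (simp add: add_pos_pos)
  have v: "?v \<in> UC_kappa \<kappa>" using Cons.prems u by (intro step_UC) auto
  have w: "?w n \<in> UC_kappa \<kappa>" for n using Cons.prems(2)[of n] u by (auto intro!: step_UC)
  have h: "?h n \<ge> 0" for n using Cons.prems(2)[of n] by simp
  have lim: "?h \<longlonglongrightarrow> b - a" using Cons.prems(3) by (intro tendsto_diff) auto
  have "(\<lambda>n. exp (\<alpha> * ?h n)) \<longlonglongrightarrow> exp (\<alpha> * (b - a))" by (intro tendsto_exp tendsto_mult_left lim)
  then have "\<forall>\<^sub>F n in sequentially. exp (\<alpha> * ?h n) < K" by (rule order_tendstoD) (simp add: K_def)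
  moreover have "\<forall>\<^sub>F n in sequentially. kappa_close \<kappa> (e / 2) (E (?h n) ?v) (E (b - a) ?v)"
    using Cons.prems(4) by (intro E_time_limit v h lim) auto
  moreover have "\<forall>\<^sub>F n in sequentially. kappa_close \<kappa> (e / (2 * K)) (?w n) ?v"
    using Cons.prems K by (intro Cons.IH) auto
  ultimately show ?case
  proof eventually_elim
    case (elim n)
    have "exp (\<alpha> * ?h n) * (e / (2 * K)) \<le> K * (e / (2 * K))"
      using elim(1) K Cons.prems(4) by (intro mult_right_mono) auto
    then have "kappa_close \<kappa> (e / 2) (E (?h n) (?w n)) (E (?h n) ?v)"
      using K by (intro kappa_close_mono[OF E_kappa_close[OF w v h elim(3)]]) simp
    from kappa_close_triangle[OF this elim(2)] show ?case by simp
  qed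
qed

end

section \<open>Partitions\<close>

lemma Min_partition: "\<pi> \<in> partitions \<Longrightarrow> Min \<pi> = 0"
  by (auto simp: partitions_def intro!: Min_eqI)

lemma sorted_hd_eq_Min: "sorted xs \<Longrightarrow> xs \<noteq> [] \<Longrightarrow> hd xs = Min (set xs)"
  by (cases xs) (auto intro!: Min_eqI[symmetric])

lemma sorted_last_eq_Max:
  assumes "sorted xs" "xs \<noteq> []"
  shows "last xs = Max (set xs)"
proof (rule Max_eqI[symmetric])
  fix y assume "y \<in> set xs"
  then show "y \<le> last xs" using assms by (induction xs) auto
qed (use assms in auto)

lemma partitions_uptoD:
  assumes "\<pi> \<in> partitions_upto t"
  shows "finite \<pi>" "0 \<in> \<pi>" "t \<in> \<pi>" "\<pi> \<subseteq> {0..t}"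
proof -
  show *: "finite \<pi>" "0 \<in> \<pi>" using assms by (auto simp: partitions_upto_def partitions_def)
  then have "Max \<pi> \<in> \<pi>" by (intro Max_in) auto
  then show "t \<in> \<pi>" using assms by (auto simp: partitions_upto_def)
  have "x \<le> t" if "x \<in> \<pi>" for x
    using that Max_ge[OF *(1), of x] assms by (auto simp: partitions_upto_def)
  then show "\<pi> \<subseteq> {0..t}" using assms by (auto simp: partitions_upto_def partitions_def)
qed

lemma partitions_uptoI:
  assumes "finite \<pi>" "0 \<in> \<pi>" "t \<in> \<pi>" "\<pi> \<subseteq> {0..t}"
  shows "\<pi> \<in> partitions_upto t"
  using assms by (auto simp: partitions_upto_def partitions_def intro!: Max_eqI)

lemma partition_sorted_list:
  assumes \<pi>: "\<pi> \<in> partitions_upto t" and ts: "sorted ts" "set ts = \<pi>"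
  obtains as where "ts = 0 # as" "last ts = t"
proof -
  have "ts \<noteq> []" using partitions_uptoD(2)[OF \<pi>] ts by auto
  moreover from this have "hd ts = 0" "last ts = t"
    using \<pi> ts sorted_hd_eq_Min[of ts] sorted_last_eq_Max[of ts] Min_partition[of \<pi>]
    by (auto simp: partitions_upto_def)
  ultimately show ?thesis using that[of "tl ts"] by (cases ts) auto
qed

text \<open>The nearest point of \<open>\<pi>\<close> to the left of \<open>s\<close> works, since \<open>s\<close> lies before its successor. If
  there is no successor, then \<open>s = t\<close> is itself a point of \<open>\<pi>\<close>.\<close>

lemma mesh_approx:
  assumes \<pi>: "\<pi> \<in> partitions_upto t" and s: "s \<in> {0..t}"
  obtains p where "p \<in> \<pi>" "p \<le> s" "s - p \<le> mesh \<pi>"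
proof -
  note fin = partitions_uptoD(1)[OF \<pi>]
  let ?ts = "sorted_list_of_set \<pi>"
  have ts: "sorted ?ts" "set ?ts = \<pi>" using fin by auto
  define p where "p = Max {q\<in>\<pi>. q \<le> s}"
  have ne: "{q\<in>\<pi>. q \<le> s} \<noteq> {}" using partitions_uptoD(2)[OF \<pi>] s by auto
  have p: "p \<in> \<pi>" "p \<le> s" using Max_in[OF _ ne] fin by (auto simp: p_def)
  have max: "q \<le> p" if "q \<in> \<pi>" "q \<le> s" for q
    unfolding p_def using that fin by (intro Max_ge) auto
  obtain i where i: "i < length ?ts" "?ts ! i = p" using p(1) ts(2) by (metis in_set_conv_nth)
  have "s - p \<le> mesh \<pi>"
  proof (cases "Suc i < length ?ts")
    case True
    then have "\<pi> \<noteq> {0}" by auto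
    moreover have "?ts ! Suc i - ?ts ! (Suc i - 1)
        \<le> Max ((\<lambda>j. ?ts ! j - ?ts ! (j - 1)) ` {1..<length ?ts})"
      using True by (intro Max_ge finite_imageI image_eqI[of _ _ "Suc i"]) auto
    ultimately have "?ts ! Suc i - p \<le> mesh \<pi>" by (simp add: mesh_def Let_def i)
    moreover have "?ts ! Suc i > s"
    proof (rule ccontr)
      assume "\<not> ?ts ! Suc i > s"
      then have "?ts ! Suc i \<le> ?ts ! i" using True ts(2) max i(2) by (metis not_le nth_mem)
      moreover have "?ts ! i < ?ts ! Suc i"
        using strict_sorted_list_of_set[of \<pi>] True
        by (simp add: sorted_wrt_nth_less)
      ultimately show False by simp
    qed
    ultimately show ?thesis by simp
  next
    case False
    then have "i = length ?ts - 1" using i by simp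
    then have "p = last ?ts" using i by (metis last_conv_nth list.size(3) not_less_zero)
    then have pt: "p = t" using partition_sorted_list[OF \<pi> ts] by metis
    then have sp: "s = p" using s p by auto
    show ?thesis
    proof (cases "\<pi> = {0}")
      case True
      then show ?thesis using sp by (simp add: mesh_def)
    next
      case False
      obtain as where as: "?ts = 0 # as" using partition_sorted_list[OF \<pi> ts] by metis
      with False ts have "as \<noteq> []" by auto
      then have len: "1 < length ?ts" using as by (cases as) auto
      have "0 \<le> ?ts ! 1 - ?ts ! (1 - 1)" using sorted_nth_mono[OF ts(1), of 0 1] len by simp
      also have "\<dots> \<le> Max ((\<lambda>j. ?ts ! j - ?ts ! (j - 1)) ` {1..<length ?ts})"
        using len by (intro Max_ge finite_imageI image_eqI[of _ _ 1]) auto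
      finally show ?thesis using sp False by (simp add: mesh_def Let_def)
    qed
  qed
  with p that show ?thesis by blast
qed

definition uniform_partition :: "real \<Rightarrow> nat \<Rightarrow> real set" where
  "uniform_partition t n = (\<lambda>k. real k * (t / real n)) ` {..n}"

lemma uniform_partition_upto:
  assumes "t \<ge> 0" "n \<ge> 1"
  shows "uniform_partition t n \<in> partitions_upto t"
proof (rule partitions_uptoI)
  show "uniform_partition t n \<subseteq> {0..t}"
    using assms by (auto simp: uniform_partition_def field_simps intro!: mult_left_mono)
  show "0 \<in> uniform_partition t n" "t \<in> uniform_partition t n"
    using assms by (force simp: uniform_partition_def)+
qed (simp add: uniform_partition_def)

lemma uniform_partition_double: "uniform_partition t n \<subseteq> uniform_partition t (2 * n)"
proof
  fix x assume "x \<in> uniform_partition t n"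
  then obtain k where "k \<le> n" "x = real k * (t / real n)" by (auto simp: uniform_partition_def)
  then have "2 * k \<in> {..2 * n}" "x = real (2 * k) * (t / real (2 * n))" by auto
  then show "x \<in> uniform_partition t (2 * n)" unfolding uniform_partition_def by blast
qed

lemma uniform_partition_approx:
  assumes "s \<in> {0..t}" "n \<ge> 1" "t / real n < e"
  shows "\<exists>p\<in>uniform_partition t n. s - e < p \<and> p \<le> s"
proof (cases "t = 0")
  case True
  then show ?thesis using assms by (auto simp: uniform_partition_def)
next
  case False
  then have t: "t > 0" using assms by auto
  define h where "h = t / real n"
  have h: "h > 0" using t assms by (simp add: h_def)
  define k where "k = nat \<lfloor>s / h\<rfloor>"
  have k: "real k \<le> s / h" "s / h < real k + 1" using assms h by (auto simp: k_def)
  then have "real k * h \<le> s" "s < real k * h + h" using h by (auto simp: field_simps)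
  moreover have "k \<le> n"
  proof -
    have "real k * h \<le> real n * h" using \<open>real k * h \<le> s\<close> assms by (simp add: h_def)
    then show ?thesis using h by simp
  qed
  ultimately show ?thesis
    using assms(3) by (intro bexI[of _ "real k * h"]) (auto simp: uniform_partition_def h_def)
qed

section \<open>Partition operators and their envelope\<close>

context Feller_family
begin

text \<open>Two weakly increasing lists with the same set of times refine each other, so repetitions
  do not change the product. In particular, the list of the times \<open>k * (t / n)\<close> may be used
  even for \<open>t = 0\<close>, where all of them coincide.\<close>

lemma partition_operator_eq_step:
  assumes \<pi>: "\<pi> \<in> partitions_upto t" and ts: "sorted ts" "set ts = \<pi>" and u: "u \<in> UC_kappa \<kappa>"
  shows "partition_operator \<Lambda> S \<pi> u = step ts u"
proof -
  obtain as where as: "ts = 0 # as" "last ts = t" using partition_sorted_list[OF \<pi> ts] .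
  have ss: "sorted (sorted_list_of_set \<pi>)" "set (sorted_list_of_set \<pi>) = \<pi>"
    using partitions_uptoD(1)[OF \<pi>] by auto
  obtain bs where bs: "sorted_list_of_set \<pi> = 0 # bs" "last (sorted_list_of_set \<pi>) = t"
    using partition_sorted_list[OF \<pi> ss] .
  have "set (0 # bs) = set (0 # as)" using ss(2) ts(2) as(1) bs(1) by simp
  then have "step (0 # bs) u = step (0 # as) u"
    using ss(1) ts(1) as bs u by (intro antisym step_refine) auto
  then show ?thesis by (simp add: partition_operator_def as bs)
qed

lemma step_le_partition_operator:
  assumes \<pi>: "\<pi> \<in> partitions_upto t" and as: "sorted (0 # as)" "set (0 # as) \<subseteq> \<pi>" "last (0 # as) = t"
    and u: "u \<in> UC_kappa \<kappa>"
  shows "step (0 # as) u \<le> partition_operator \<Lambda> S \<pi> u"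
proof -
  have ss: "sorted (sorted_list_of_set \<pi>)" "set (sorted_list_of_set \<pi>) = \<pi>"
    using partitions_uptoD(1)[OF \<pi>] by auto
  obtain bs where bs: "sorted_list_of_set \<pi> = 0 # bs" "last (sorted_list_of_set \<pi>) = t"
    using partition_sorted_list[OF \<pi> ss] .
  show ?thesis
    using ss as bs u unfolding partition_operator_def bs(1) by (intro step_refine) auto
qed

lemma partition_as_step:
  assumes \<pi>: "\<pi> \<in> partitions_upto t"
  obtains as where "sorted (0 # as)" "set (0 # as) = \<pi>" "last (0 # as) = t"
    "partition_operator \<Lambda> S \<pi> = step (0 # as)"
proof -
  have ss: "sorted (sorted_list_of_set \<pi>)" "set (sorted_list_of_set \<pi>) = \<pi>"
    using partitions_uptoD(1)[OF \<pi>] by auto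
  obtain bs where "sorted_list_of_set \<pi> = 0 # bs" "last (sorted_list_of_set \<pi>) = t"
    using partition_sorted_list[OF \<pi> ss] .
  with ss that[of bs] show ?thesis by (simp add: partition_operator_def fun_eq_iff)
qed

lemma partition_operator_mono:
  assumes "\<pi> \<in> partitions_upto t" "\<rho> \<in> partitions_upto t" "\<pi> \<subseteq> \<rho>" "u \<in> UC_kappa \<kappa>"
  shows "partition_operator \<Lambda> S \<pi> u \<le> partition_operator \<Lambda> S \<rho> u"
proof -
  obtain as where as: "sorted (0 # as)" "set (0 # as) = \<pi>" "last (0 # as) = t"
    "partition_operator \<Lambda> S \<pi> = step (0 # as)"
    using partition_as_step[OF assms(1)] by blast
  show ?thesis unfolding as(4)
    using assms(3,4) as by (intro step_le_partition_operator[OF assms(2)]) auto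
qed

context
  fixes t \<pi> assumes \<pi>: "\<pi> \<in> partitions_upto t"
begin

lemma partition_operator_UC: "u \<in> UC_kappa \<kappa> \<Longrightarrow> partition_operator \<Lambda> S \<pi> u \<in> UC_kappa \<kappa>"
  by (rule partition_as_step[OF \<pi>]) (simp only: step_UC)

lemma partition_operator_kappa_close:
  assumes "u \<in> UC_kappa \<kappa>" "v \<in> UC_kappa \<kappa>" "kappa_close \<kappa> c u v"
  shows "kappa_close \<kappa> (exp (\<alpha> * t) * c) (partition_operator \<Lambda> S \<pi> u) (partition_operator \<Lambda> S \<pi> v)"
proof -
  obtain as where as: "sorted (0 # as)" "last (0 # as) = t"
    "partition_operator \<Lambda> S \<pi> = step (0 # as)"
    using partition_as_step[OF \<pi>] by blast
  show ?thesis using step_kappa_close[OF as(1) assms] unfolding as by simp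
qed

lemma partition_operator_Lipschitz:
  assumes "L-lipschitz_on UNIV u" "\<And>x. \<bar>u x\<bar> \<le> c"
  shows "(exp (\<beta> * t) * L)-lipschitz_on UNIV (partition_operator \<Lambda> S \<pi> u)"
    and "\<bar>partition_operator \<Lambda> S \<pi> u x\<bar> \<le> c"
proof -
  obtain as where as: "sorted (0 # as)" "last (0 # as) = t"
    "partition_operator \<Lambda> S \<pi> = step (0 # as)"
    using partition_as_step[OF \<pi>] by blast
  show "(exp (\<beta> * t) * L)-lipschitz_on UNIV (partition_operator \<Lambda> S \<pi> u)"
    "\<bar>partition_operator \<Lambda> S \<pi> u x\<bar> \<le> c"
    using step_Lipschitz[OF as(1) assms] unfolding as by simp_all
qed

lemma partition_operator_const: "partition_operator \<Lambda> S \<pi> (\<lambda>_. c) = (\<lambda>_. c)"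
proof -
  obtain as where as: "sorted (0 # as)" "partition_operator \<Lambda> S \<pi> = step (0 # as)"
    using partition_as_step[OF \<pi>] by blast
  have "step (s # ts) (\<lambda>_. c) = (\<lambda>_. c)" if "sorted (s # ts)" for s ts
    using that by (induction ts arbitrary: s) (auto simp: E_const)
  with as show ?thesis by simp
qed

end

lemma bdd_above_partition_operators:
  assumes u: "u \<in> UC_kappa \<kappa>"
  shows "bdd_above ((\<lambda>\<pi>. partition_operator \<Lambda> S \<pi> u x) ` partitions_upto t)"
proof -
  obtain c where c: "kappa_close \<kappa> c u (\<lambda>_. 0)" using UC_kappa_bound[OF u] .
  have "partition_operator \<Lambda> S \<pi> u x \<le> exp (\<alpha> * t) * c / \<kappa> x" if \<pi>: "\<pi> \<in> partitions_upto t" for \<pi>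
  proof -
    have "\<kappa> x * \<bar>partition_operator \<Lambda> S \<pi> u x\<bar> \<le> exp (\<alpha> * t) * c"
      using kappa_closeD[OF partition_operator_kappa_close[OF \<pi> u Lip_b_UC[OF Lip_b_const] c], of x]
      by (simp add: partition_operator_const[OF \<pi>])
    then have "\<bar>partition_operator \<Lambda> S \<pi> u x\<bar> \<le> exp (\<alpha> * t) * c / \<kappa> x"
      using weight_pos[of x] by (simp add: field_simps)
    then show ?thesis by linarith
  qed
  then show ?thesis by (rule bdd_aboveI2)
qed

lemma partition_operator_le_envelope:
  assumes "u \<in> UC_kappa \<kappa>" "\<pi> \<in> partitions_upto t"
  shows "partition_operator \<Lambda> S \<pi> u x \<le> semigroup_envelope \<Lambda> S t u x"
  unfolding semigroup_envelope_def
  using assms by (intro cSUP_upper bdd_above_partition_operators)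

context
  fixes t assumes t: "(t::real) \<ge> 0"
begin

lemma partitions_upto_nonempty: "partitions_upto t \<noteq> {}"
  using uniform_partition_upto[OF t, of 1] by auto

lemma envelope_kappa_close:
  assumes "u \<in> UC_kappa \<kappa>" "v \<in> UC_kappa \<kappa>" "kappa_close \<kappa> c u v"
  shows "kappa_close \<kappa> (exp (\<alpha> * t) * c) (semigroup_envelope \<Lambda> S t u) (semigroup_envelope \<Lambda> S t v)"
  unfolding semigroup_envelope_def
  using assms by (intro kappa_close_SUP partitions_upto_nonempty bdd_above_partition_operators
      partition_operator_kappa_close)

text \<open>The bounds of the partition operators are uniform in the partition, and are inherited by the
  pointwise supremum.\<close>

lemma envelope_Lip_b:
  assumes u: "u \<in> Lip_b"
  shows "semigroup_envelope \<Lambda> S t u \<in> Lip_b"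
proof -
  obtain c L where c: "\<And>x. \<bar>u x\<bar> \<le> c" and L: "L-lipschitz_on UNIV u"
    using u by (auto simp: Lip_b_iff)
  note P = partition_operator_Lipschitz[OF _ L c]
  note bdd = bdd_above_partition_operators[OF Lip_b_UC[OF u]]
  show ?thesis
  proof (rule Lip_bI)
    fix x
    have "\<bar>(SUP \<pi>\<in>partitions_upto t. partition_operator \<Lambda> S \<pi> u x) - (SUP \<pi>\<in>partitions_upto t. 0)\<bar> \<le> c"
      using P(2) by (intro abs_SUP_diff_le partitions_upto_nonempty bdd) auto
    then show "\<bar>semigroup_envelope \<Lambda> S t u x\<bar> \<le> c"
      using partitions_upto_nonempty by (simp add: semigroup_envelope_def)
  next
    show "(exp (\<beta> * t) * L)-lipschitz_on UNIV (semigroup_envelope \<Lambda> S t u)"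
    proof (rule lipschitz_onI)
      fix x y
      show "dist (semigroup_envelope \<Lambda> S t u x) (semigroup_envelope \<Lambda> S t u y)
          \<le> exp (\<beta> * t) * L * dist x y"
        unfolding semigroup_envelope_def dist_real_def
        using lipschitz_onD[OF P(1), of _ t x y]
        by (intro abs_SUP_diff_le partitions_upto_nonempty bdd) (auto simp: dist_real_def)
    qed (use lipschitz_on_nonneg[OF L] in simp)
  qed
qed

text \<open>A supremum of functions in \<open>UC_kappa\<close> need not lie in \<open>UC_kappa\<close>. Here it does, because the
  envelope is Lipschitz in \<open>u\<close> and maps \<open>Lip_b\<close> to itself.\<close>

lemma envelope_UC:
  assumes u: "u \<in> UC_kappa \<kappa>"
  shows "semigroup_envelope \<Lambda> S t u \<in> UC_kappa \<kappa>"
proof (rule UC_closed)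
  fix e :: real assume "e > 0"
  then have "e / exp (\<alpha> * t) > 0" by simp
  then obtain v where v: "v \<in> Lip_b" "kappa_close \<kappa> (e / exp (\<alpha> * t)) u v"
    using u unfolding UC_kappa_iff by blast
  have "kappa_close \<kappa> e (semigroup_envelope \<Lambda> S t u) (semigroup_envelope \<Lambda> S t v)"
    using envelope_kappa_close[OF u Lip_b_UC[OF v(1)] v(2)] by simp
  then show "\<exists>w\<in>UC_kappa \<kappa>. kappa_close \<kappa> e (semigroup_envelope \<Lambda> S t u) w"
    using Lip_b_UC[OF envelope_Lip_b[OF v(1)]] by blast
qed

end

text \<open>Rounding the times of \<open>\<rho>\<close> down to \<open>\<pi> n\<close> gives a weakly increasing list of times in \<open>\<pi> n\<close>,
  whose product of steps is below the partition operator of \<open>\<pi> n\<close>. Density makes the rounded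
  times converge to the original ones, and the products converge with them.\<close>

lemma partition_operator_le_SUP:
  assumes \<pi>: "\<And>n. \<pi> n \<in> partitions_upto t" "\<And>n. \<pi> n \<subseteq> \<pi> (Suc n)"
    and dense: "\<And>s e. s \<in> {0..t} \<Longrightarrow> e > 0 \<Longrightarrow> \<exists>n. \<exists>p\<in>\<pi> n. s - e < p \<and> p \<le> s"
    and \<rho>: "\<rho> \<in> partitions_upto t" and u: "u \<in> UC_kappa \<kappa>"
  shows "partition_operator \<Lambda> S \<rho> u x \<le> (SUP n. partition_operator \<Lambda> S (\<pi> n) u x)"
    (is "_ \<le> ?sup")
proof -
  \<comment> \<open>Rounding down to \<open>\<pi> n\<close>; it is monotone and fixes \<open>0\<close> and \<open>t\<close>.\<close>
  define r where "r = (\<lambda>n s. Max {p\<in>\<pi> n. p \<le> s})"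
  note part = partitions_uptoD[OF \<pi>(1)]
  have r_max: "p \<le> r n s" if "p \<in> \<pi> n" "p \<le> s" for p n s
    unfolding r_def using that part(1)[of n] by (intro Max_ge) auto
  have r_in: "r n s \<in> \<pi> n \<and> r n s \<le> s" if "s \<ge> 0" for n s
  proof -
    have "{p\<in>\<pi> n. p \<le> s} \<noteq> {}" using part(2)[of n] that by auto
    from Max_in[OF _ this] show ?thesis using part(1)[of n] by (simp add: r_def)
  qed
  have r_fix: "r n s = s" if "s \<in> \<pi> n" for n s
    using r_max[OF that order_refl] r_in[of s n] part(4)[of n] that by force
  have r_mono: "r n s \<le> r n s'" if "0 \<le> s" "s \<le> s'" for n s s'
    using r_in[OF that(1), of n] that(2) by (intro r_max) auto
  have nested: "\<pi> m \<subseteq> \<pi> n" if "m \<le> n" for m n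
    using lift_Suc_mono_le[of \<pi>, OF \<pi>(2) that] .
  have r_lim: "(\<lambda>n. r n s) \<longlonglongrightarrow> s" if s: "s \<in> {0..t}" for s
  proof (rule LIMSEQ_I)
    fix e :: real assume "e > 0"
    then obtain m p where m: "p \<in> \<pi> m" "s - e < p" "p \<le> s" using dense[OF s] by blast
    have "norm (r n s - s) < e" if "n \<ge> m" for n
      using r_max[of p n s] nested[OF that] m r_in[of s n] s by auto
    then show "\<exists>m. \<forall>n\<ge>m. norm (r n s - s) < e" by blast
  qed
  obtain as where as: "sorted (0 # as)" "set (0 # as) = \<rho>" "last (0 # as) = t"
    "partition_operator \<Lambda> S \<rho> = step (0 # as)"
    using partition_as_step[OF \<rho>] by blast
  have as_sub: "set (0 # as) \<subseteq> {0..t}" using as(2) partitions_uptoD(4)[OF \<rho>] by simp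
  have sorted_r: "sorted (map (r n) (0 # as))" for n
    using as(1) as_sub by (intro sorted_map_mono) (auto intro!: r_mono mono_onI)
  have step_le: "step (map (r n) (0 # as)) u x \<le> ?sup" for n
  proof -
    have map: "map (r n) (0 # as) = 0 # map (r n) as" using part(2)[of n] r_fix by simp
    have "last (map (r n) (0 # as)) = t"
      using as(3) part(3)[of n] r_fix by (metis last_map list.distinct(1))
    then have "step (map (r n) (0 # as)) u \<le> partition_operator \<Lambda> S (\<pi> n) u"
      using sorted_r[of n] as_sub r_in[of _ n] part(2)[of n] u unfolding map
      by (intro step_le_partition_operator[OF \<pi>(1)]) auto
    moreover have "bdd_above (range (\<lambda>n. partition_operator \<Lambda> S (\<pi> n) u x))"
      using bdd_above_partition_operators[OF u, of x t] by (rule bdd_above_mono) (use \<pi>(1) in auto)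
    then have "partition_operator \<Lambda> S (\<pi> n) u x \<le> ?sup" by (rule cSUP_upper[OF UNIV_I])
    ultimately show ?thesis by (meson le_funD order_trans)
  qed
  show ?thesis
  proof (rule field_le_epsilon)
    fix e :: real assume "e > 0"
    \<comment> \<open>The radius \<open>e * \<kappa> x\<close> turns weighted closeness into closeness up to \<open>e\<close> at \<open>x\<close>.\<close>
    then have "\<forall>\<^sub>F n in sequentially.
        kappa_close \<kappa> (e * \<kappa> x) (step (map (r n) (0 # as)) u) (step (0 # as) u)"
      using as_sub weight_pos[of x] by (intro step_limit as(1) sorted_r r_lim u) auto
    then obtain n where n: "kappa_close \<kappa> (e * \<kappa> x) (step (map (r n) (0 # as)) u) (step (0 # as) u)"
      by (auto simp: eventually_sequentially simp del: list.map)
    have "\<bar>step (map (r n) (0 # as)) u x - step (0 # as) u x\<bar> \<le> e"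
      using kappa_closeD[OF n, of x] weight_pos[of x] by (simp add: mult.commute[of e] del: list.map)
    with step_le[of n] show "partition_operator \<Lambda> S \<rho> u x \<le> ?sup + e" unfolding as(4) by linarith
  qed
qed

text \<open>Density of the union of the partitions is all that matters about the mesh; in this form the
  result applies to meshes tending to zero and to dyadic partitions alike.\<close>

lemma partition_operators_increase_to_envelope:
  assumes t: "t \<ge> 0" and \<pi>: "\<And>n. \<pi> n \<in> partitions_upto t" "\<And>n. \<pi> n \<subseteq> \<pi> (Suc n)"
    and dense: "\<And>s e. s \<in> {0..t} \<Longrightarrow> e > 0 \<Longrightarrow> \<exists>n. \<exists>p\<in>\<pi> n. s - e < p \<and> p \<le> s"
    and u: "u \<in> UC_kappa \<kappa>"
  shows "increases_to \<kappa> (\<lambda>n. partition_operator \<Lambda> S (\<pi> n) u) (semigroup_envelope \<Lambda> S t u)"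
proof -
  let ?P = "\<lambda>n. partition_operator \<Lambda> S (\<pi> n) u"
  have mono: "?P n \<le> ?P (Suc n)" for n
    by (rule partition_operator_mono[OF \<pi>(1) \<pi>(1) \<pi>(2) u])
  have "(\<lambda>n. ?P n x) \<longlonglongrightarrow> semigroup_envelope \<Lambda> S t u x" for x
  proof -
    have bdd: "bdd_above (range (\<lambda>n. ?P n x))"
      using bdd_above_partition_operators[OF u, of x t] by (rule bdd_above_mono) (use \<pi>(1) in auto)
    have "incseq (\<lambda>n. ?P n x)" using mono by (auto simp: incseq_Suc_iff le_fun_def)
    then have "(\<lambda>n. ?P n x) \<longlonglongrightarrow> (SUP n. ?P n x)" by (rule LIMSEQ_incseq_SUP[OF bdd])
    moreover have "(SUP n. ?P n x) = semigroup_envelope \<Lambda> S t u x"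
    proof (rule antisym)
      show "(SUP n. ?P n x) \<le> semigroup_envelope \<Lambda> S t u x"
        by (intro cSUP_least partition_operator_le_envelope u \<pi>) simp
      show "semigroup_envelope \<Lambda> S t u x \<le> (SUP n. ?P n x)"
        unfolding semigroup_envelope_def
        by (intro cSUP_least partitions_upto_nonempty[OF t] partition_operator_le_SUP[where t = t] \<pi> dense u)
    qed
    ultimately show ?thesis by simp
  qed
  then show ?thesis
    using mono by (simp add: increases_to_def partition_operator_UC[OF \<pi>(1) u] envelope_UC[OF t u])
qed

lemma step_uniform:
  "step (map (\<lambda>k. real k * h) [m..<Suc (m + n)]) u = (E h ^^ n) u"
proof (induction n arbitrary: m)
  case (Suc n)
  have "[m..<Suc (m + Suc n)] = m # [Suc m..<Suc (Suc m + n)]"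
    "[Suc m..<Suc (Suc m + n)] = Suc m # [Suc (Suc m)..<Suc (Suc m + n)]"
    by (simp_all add: upt_conv_Cons del: upt_Suc)
  then have "step (map (\<lambda>k. real k * h) [m..<Suc (m + Suc n)]) u
      = E (real (Suc m) * h - real m * h) (step (map (\<lambda>k. real k * h) [Suc m..<Suc (Suc m + n)]) u)"
    by (simp del: upt_Suc of_nat_Suc)
  also have "real (Suc m) * h - real m * h = h" by (simp add: algebra_simps)
  finally show ?case unfolding Suc.IH by (simp only: funpow.simps o_apply)
qed simp

lemma partition_operator_uniform:
  assumes t: "t \<ge> 0" and n: "n \<ge> 1" and u: "u \<in> UC_kappa \<kappa>"
  shows "partition_operator \<Lambda> S (uniform_partition t n) u = (E (t / real n) ^^ n) u"
proof -
  let ?ts = "map (\<lambda>k. real k * (t / real n)) [0..<Suc (0 + n)]"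
  have "sorted ?ts"
    using t by (intro sorted_map_mono) (auto intro!: mono_onI mult_right_mono divide_nonneg_nonneg
        simp del: upt_Suc times_divide_eq_right)
  moreover have "set ?ts = uniform_partition t n"
    by (simp add: uniform_partition_def atLeast0LessThan lessThan_Suc_atMost del: upt_Suc)
  ultimately have "partition_operator \<Lambda> S (uniform_partition t n) u = step ?ts u"
    using u by (intro partition_operator_eq_step[OF uniform_partition_upto[OF t n]])
  then show ?thesis by (simp only: step_uniform)
qed

lemma dyadic_limit:
  assumes t: "t \<ge> 0" and u: "u \<in> UC_kappa \<kappa>"
  shows "(\<lambda>n. (E (t / 2 ^ n) ^^ (2 ^ n)) u x) \<longlonglongrightarrow> semigroup_envelope \<Lambda> S t u x"
proof -
  have "\<exists>n. \<exists>p\<in>uniform_partition t (2 ^ n). s - e < p \<and> p \<le> s"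
    if s: "s \<in> {0..t}" and e: "e > 0" for s e
  proof -
    have "(\<lambda>n. t / 2 ^ n) \<longlonglongrightarrow> 0" by (rule LIMSEQ_divide_realpow_zero) simp
    then have "\<forall>\<^sub>F n in sequentially. t / 2 ^ n < e" using e by (rule order_tendstoD)
    then obtain n where "t / 2 ^ n < e" by (auto simp: eventually_sequentially)
    with uniform_partition_approx[OF s, of "2 ^ n" e] show ?thesis by auto
  qed
  then have "increases_to \<kappa> (\<lambda>n. partition_operator \<Lambda> S (uniform_partition t (2 ^ n)) u)
      (semigroup_envelope \<Lambda> S t u)"
    using uniform_partition_double
    by (intro partition_operators_increase_to_envelope t u uniform_partition_upto) simp_all
  then show ?thesis
    using partition_operator_uniform[OF t _ u, of "2 ^ _"] by (simp add: increases_to_def)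
qed

text \<open>Uniform partitions with arbitrary \<open>n\<close> are not nested, but the dyadic ones among them already
  reach the envelope.\<close>

lemma envelope_eq_SUP_uniform:
  assumes t: "t \<ge> 0" and u: "u \<in> UC_kappa \<kappa>"
  shows "semigroup_envelope \<Lambda> S t u x = (SUP n\<in>{1..}. (E (t / real n) ^^ n) u x)"
proof (rule antisym)
  have le: "(E (t / real n) ^^ n) u x \<le> semigroup_envelope \<Lambda> S t u x" if "n \<in> {1..}" for n
    using that partition_operator_uniform[OF t _ u, of n]
      partition_operator_le_envelope[OF u uniform_partition_upto[OF t], of n x] by simp
  then show "(SUP n\<in>{1..}. (E (t / real n) ^^ n) u x) \<le> semigroup_envelope \<Lambda> S t u x"
    by (intro cSUP_least) auto
  have "bdd_above ((\<lambda>n. (E (t / real n) ^^ n) u x) ` {1..})" using le by (rule bdd_aboveI2)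
  then have "(E (t / 2 ^ n) ^^ (2 ^ n)) u x \<le> (SUP n\<in>{1..}. (E (t / real n) ^^ n) u x)" for n
    using cSUP_upper[of "2 ^ n" "{1..}" "\<lambda>n. (E (t / real n) ^^ n) u x"] by simp
  then show "semigroup_envelope \<Lambda> S t u x \<le> (SUP n\<in>{1..}. (E (t / real n) ^^ n) u x)"
    by (intro LIMSEQ_le_const2[OF dyadic_limit[OF t u]]) auto
qed

end

theorem proposition2p7:
  fixes \<Lambda> :: "'l set"
    and \<kappa> :: "'a::metric_space \<Rightarrow> real"
    and S :: "'l \<Rightarrow> real \<Rightarrow> ('a \<Rightarrow> real) \<Rightarrow> ('a \<Rightarrow> real)"
    and \<alpha> \<beta> t :: real
  assumes "\<Lambda> \<noteq> {}"
    and "separable_space (euclidean :: 'a topology)"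
    and "continuous_on UNIV \<kappa>" and "bounded (range \<kappa>)" and "\<And>x. \<kappa> x > 0"
    and Feller: "\<And>l. l \<in> \<Lambda> \<Longrightarrow> Feller_semigroup \<kappa> (S l)"
    and linear: "\<And>l s. l \<in> \<Lambda> \<Longrightarrow> s \<ge> 0 \<Longrightarrow> linear_operator \<kappa> (S l s)"
    and unit: "\<And>l s. l \<in> \<Lambda> \<Longrightarrow> s \<ge> 0 \<Longrightarrow> S l s (\<lambda>x. 1) = (\<lambda>x. 1)"
    and growth: "\<And>l s u. l \<in> \<Lambda> \<Longrightarrow> s \<ge> 0 \<Longrightarrow> u \<in> Lip_b \<Longrightarrow>
      kappa_norm \<kappa> (S l s u) \<le> ennreal (exp (\<alpha> * s)) * kappa_norm \<kappa> u"
    and Lip_growth: "\<And>l s u. l \<in> \<Lambda> \<Longrightarrow> s \<ge> 0 \<Longrightarrow> u \<in> Lip_b \<Longrightarrow>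
      Lip_norm (S l s u) \<le> ennreal (exp (\<beta> * s)) * Lip_norm u"
    and time_cont: "\<And>u. u \<in> UC_kappa \<kappa> \<Longrightarrow>
      continuous_map (top_of_set {0..}) (UC_kappa_top \<kappa>) (\<lambda>h. sup_operator \<Lambda> S h u)"
    and "t \<ge> 0"
  shows "(\<forall>\<pi> :: nat \<Rightarrow> real set.
            (\<forall>n. \<pi> n \<in> partitions_upto t) \<and> (\<forall>n. \<pi> n \<subseteq> \<pi> (Suc n)) \<and>
            decseq (\<lambda>n. mesh (\<pi> n)) \<and> (\<lambda>n. mesh (\<pi> n)) \<longlonglongrightarrow> 0 \<longrightarrow>
            (\<forall>u\<in>UC_kappa \<kappa>.
               increases_to \<kappa> (\<lambda>n. partition_operator \<Lambda> S (\<pi> n) u) (semigroup_envelope \<Lambda> S t u)))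
       \<and> (\<forall>u\<in>UC_kappa \<kappa>. \<forall>x.
            semigroup_envelope \<Lambda> S t u x = (SUP n\<in>{1..}. (sup_operator \<Lambda> S (t / real n) ^^ n) u x) \<and>
            (\<lambda>n. (sup_operator \<Lambda> S (t / 2 ^ n) ^^ (2 ^ n)) u x) \<longlonglongrightarrow> semigroup_envelope \<Lambda> S t u x)"
proof -
  interpret Feller_family \<kappa> \<Lambda> S \<alpha> \<beta>
    using assms by unfold_locales auto
  show ?thesis
  proof (intro conjI allI impI ballI)
    fix \<pi> u
    assume \<pi>: "(\<forall>n. \<pi> n \<in> partitions_upto t) \<and> (\<forall>n. \<pi> n \<subseteq> \<pi> (Suc n)) \<and>
      decseq (\<lambda>n. mesh (\<pi> n)) \<and> (\<lambda>n. mesh (\<pi> n)) \<longlonglongrightarrow> 0" and u: "u \<in> UC_kappa \<kappa>"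
    have "\<exists>n. \<exists>p\<in>\<pi> n. s - e < p \<and> p \<le> s" if s: "s \<in> {0..t}" and e: "e > 0" for s e
    proof -
      have "\<forall>\<^sub>F n in sequentially. mesh (\<pi> n) < e"
        using \<pi> e by (auto intro: order_tendstoD)
      then obtain n where n: "mesh (\<pi> n) < e" by (auto simp: eventually_sequentially)
      obtain p where "p \<in> \<pi> n" "p \<le> s" "s - p \<le> mesh (\<pi> n)"
        using mesh_approx[of "\<pi> n" t s] \<pi> s by blast
      with n show ?thesis by (intro exI[of _ n] bexI[of _ p]) auto
    qed
    then show "increases_to \<kappa> (\<lambda>n. partition_operator \<Lambda> S (\<pi> n) u) (semigroup_envelope \<Lambda> S t u)"
      using \<pi> by (intro partition_operators_increase_to_envelope assms u) auto
  qed (use assms dyadic_limit envelope_eq_SUP_uniform in auto)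
qed

end
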